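(* Let $\ell\ge 1$, let $T$ be the left shift on $\Omega=\mathcal A^{\mathbb Z}$ and $P$ a $T$-invariant probability measure as in the context. Let $q_1,\ldots,q_\ell$ be functions taking nonnegative integer values on integers $n\ge 0$, and suppose there is a constant $K>0$ such that: (a) for any $i\ne j$, $1\le i,j\le\ell$, and every integer $k$ the number of integers $n\ge 0$ satisfying at least one of the equations $q_i(n)-q_j(n)=k$ and $q_i(n)=k$ does not exceed $K$ (when $\ell=1$ the requirement is only that for every integer $k$ the number of $n\ge 0$ with $q_1(n)=k$ does not exceed $K$); (b) the number of pairs of integers $n>m\ge 0$ satisfying $\max_{1\le i\le\ell}q_i(n)\le\max_{1\le i\le\ell}q_i(m)$ does not exceed $K$. Let $C_n^{(j)}$, $j=1,\ldots,\ell$, $n\ge 1$, be cylinder sets such that for each $n\geq 1$ all of $C_n^{(1)},\ldots,C_n^{(\ell)}$ are defined on the same interval of integers $\Lambda_n$, and let $D>0$ be a constant. Set $$S_N=\sum_{n=1}^N\prod_{i=1}^\ell\mathbb I_{C_n^{(i)}}\circ T^{q_i(n)},\qquad \mathcal E_N=\sum_{n=1}^N\prod_{i=1}^\ell P(C_n^{(i)}),$$ and suppose that $\mathcal E_N\to\infty$ as $N\to\infty$. (i) If $\ell=1$, assume that $\sum_{n\ge1}\phi(n)<\infty$ and that for all $m<n$ the interval $\Lambda_m$ is right $D$-nested in $\Lambda_n$. Then, with probability one, $$\lim_{N\to\infty}\frac{S_N}{\mathcal E_N}=1.$$ (ii) If $\ell>1$, assume that $\sum_{n\ge1}\psi(n)<\infty$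 and that for all $m<n$ the interval $\Lambda_m$ is $D$-nested in $\Lambda_n$. Then, with probability one, $\lim_{N\to\infty}S_N/\mathcal E_N=1$ as well.
   Context: Sequence space: $\mathcal A$ is a finite or countable alphabet which is not a singleton, $\Omega=\mathcal A^{\mathbb Z}$ is the space of sequences $\omega=(\omega_i)_{i\in\mathbb Z}$, $\mathcal F$ is the $\sigma$-algebra generated by all cylinder sets, $T:\Omega\to\Omega$ is the left shift $(T\omega)_i=\omega_{i+1}$, and $P$ is a $T$-invariant probability measure on $(\Omega,\mathcal F)$. It is assumed that $P([a])>0$ for every $a\in\mathcal A$, where $[a]=\{\omega:\omega_0=a\}$. $\mathbb I_\Gamma$ denotes the indicator of $\Gamma$. A cylinder $C$ defined on an interval of integers $\Lambda=[l,r]$, $l\le r$, is a set $C=\{\omega:\omega_i=a_i,\ i=l,l+1,\ldots,r\}$ for some $a_l,\ldots,a_r\in\mathcal A$. Nesting: for $D>0$, an interval of integers $\Lambda_1=[l_1,r_1]$ is right $D$-nested in $\Lambda_2=[l_2,r_2]$ if $r_1<r_2+D$; it is $D$-nested in $\Lambda_2$ if $[l_1,r_1]\subset(l_2-D,r_2+D)$. Dependence coefficients: for $-\infty\le m\le n\le\infty$ let $\mathcal F_{mn}$ be the $\sigma$-algebra generated by the coordinates $\omega_i$ with $m\le i\le n$ ($i\in\mathbb Z$). For sub-$\sigma$-algebras $\mathcal G,\mathcal H$ set $$\phi(\mathcal G,\mathcal H)=\sup\Big\{\Big|\frac{P(\Gamma\cap\Delta)}{P(\Gamma)}-P(\Delta)\Big|:\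 \Gamma\in\mathcal G,\ \Delta\in\mathcal H,\ P(\Gamma)\ne 0\Big\},$$ $$\psi(\mathcal G,\mathcal H)=\sup\Big\{\Big|\frac{P(\Gamma\cap\Delta)}{P(\Gamma)P(\Delta)}-1\Big|:\ \Gamma\in\mathcal G,\ \Delta\in\mathcal H,\ P(\Gamma)P(\Delta)\ne 0\Big\}\in[0,\infty],$$ and $\phi(k)=\sup_{m\in\mathbb Z}\phi(\mathcal F_{-\infty,m},\mathcal F_{m+k,\infty})$, $\psi(k)=\sup_{m\in\mathbb Z}\psi(\mathcal F_{-\infty,m},\mathcal F_{m+k,\infty})$ for $k=0,1,2,\ldots$. *)

theory Defs
  imports "HOL-Probability.Probability"
begin

definition left_shift :: "(int \<Rightarrow> 'a) \<Rightarrow> (int \<Rightarrow> 'a)" where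
  "left_shift \<omega> = (\<lambda>i. \<omega> (i + 1))"

definition cylinder_on :: "int \<Rightarrow> int \<Rightarrow> (int \<Rightarrow> 'a) set \<Rightarrow> bool" where
  "cylinder_on l r C \<longleftrightarrow> l \<le> r \<and> (\<exists>a :: int \<Rightarrow> 'a. C = {\<omega>. \<forall>i\<in>{l..r}. \<omega> i = a i})"

definition full_shift_space :: "(int \<Rightarrow> 'a) measure" where
  "full_shift_space = sigma UNIV {C. \<exists>l r. cylinder_on l r C}"

definition shift_invariant :: "(int \<Rightarrow> 'a) measure \<Rightarrow> bool" where
  "shift_invariant P \<longleftrightarrow> left_shift \<in> measurable P P \<and> distr P P left_shift = P"

definition right_nested :: "real \<Rightarrow> int \<Rightarrow> int \<Rightarrow> int \<Rightarrow> int \<Rightarrow> bool" where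
  "right_nested D l1 r1 l2 r2 \<longleftrightarrow> real_of_int r1 < real_of_int r2 + D"

definition nested :: "real \<Rightarrow> int \<Rightarrow> int \<Rightarrow> int \<Rightarrow> int \<Rightarrow> bool" where
  "nested D l1 r1 l2 r2 \<longleftrightarrow>
     real_of_int ` {l1..r1} \<subseteq> {real_of_int l2 - D <..< real_of_int r2 + D}"

text \<open>The sigma-algebra generated by the coordinates with index in \<open>I\<close>, the alphabet
  carrying its power set. Half-lines \<open>{..m}\<close> and \<open>{m..}\<close> as \<open>I\<close> give
  \<open>\<F>\<close> with an infinite left or right end.\<close>

definition coord_algebra :: "int set \<Rightarrow> (int \<Rightarrow> 'a) set set" where
  "coord_algebra I = sigma_sets UNIV {(\<lambda>\<omega>. \<omega> i) -` B | i B. i \<in> I}"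

text \<open>Both coefficients take values in \<open>[0, \<infinity>]\<close>, so that the suprema and the series formed
  from them always exist.\<close>

definition phi_dep ::
  "(int \<Rightarrow> 'a) measure \<Rightarrow> (int \<Rightarrow> 'a) set set \<Rightarrow> (int \<Rightarrow> 'a) set set \<Rightarrow> ennreal" where
  "phi_dep P G H =
     (SUP (A, B) \<in> {(A, B). A \<in> G \<and> B \<in> H \<and> measure P A \<noteq> 0}.
        ennreal \<bar>measure P (A \<inter> B) / measure P A - measure P B\<bar>)"

definition psi_dep ::
  "(int \<Rightarrow> 'a) measure \<Rightarrow> (int \<Rightarrow> 'a) set set \<Rightarrow> (int \<Rightarrow> 'a) set set \<Rightarrow> ennreal" where
  "psi_dep P G H =
     (SUP (A, B) \<in> {(A, B). A \<in> G \<and> B \<in> H \<and> measure P A * measure P B \<noteq> 0}.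
        ennreal \<bar>measure P (A \<inter> B) / (measure P A * measure P B) - 1\<bar>)"

definition phi_coeff :: "(int \<Rightarrow> 'a) measure \<Rightarrow> nat \<Rightarrow> ennreal" where
  "phi_coeff P k = (SUP m::int. phi_dep P (coord_algebra {..m}) (coord_algebra {m + int k..}))"

definition psi_coeff :: "(int \<Rightarrow> 'a) measure \<Rightarrow> nat \<Rightarrow> ennreal" where
  "psi_coeff P k = (SUP m::int. psi_dep P (coord_algebra {..m}) (coord_algebra {m + int k..}))"

text \<open>\<open>C i n\<close> is $C_n^{(i)}$, and \<open>q i n\<close> is $q_i(n)$.\<close>

definition hit_sum ::
  "nat \<Rightarrow> (nat \<Rightarrow> nat \<Rightarrow> nat) \<Rightarrow> (nat \<Rightarrow> nat \<Rightarrow> (int \<Rightarrow> 'a) set) \<Rightarrow> nat \<Rightarrow> (int \<Rightarrow> 'a) \<Rightarrow> real" where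
  "hit_sum l q C N \<omega> =
     (\<Sum>n = 1..N. \<Prod>i = 1..l. indicator (C i n) ((left_shift ^^ q i n) \<omega>))"

definition prob_sum ::
  "(int \<Rightarrow> 'a) measure \<Rightarrow> nat \<Rightarrow> (nat \<Rightarrow> nat \<Rightarrow> (int \<Rightarrow> 'a) set) \<Rightarrow> nat \<Rightarrow> real" where
  "prob_sum P l C N = (\<Sum>n = 1..N. \<Prod>i = 1..l. measure P (C i n))"

text \<open>Finiteness is explicit because \<open>card\<close> is \<open>0\<close> on infinite sets.\<close>

definition count_at_most :: "'b set \<Rightarrow> real \<Rightarrow> bool" where
  "count_at_most A K \<longleftrightarrow> finite A \<and> real (card A) \<le> K"

end

theory Submission
  imports Defs "HOL-Real_Asymp.Real_Asymp"
begin

text \<open>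
  Write \<open>X\<^sub>n\<close> for the \<open>n\<close>-th summand of \<open>S\<^sub>N\<close> and \<open>p\<^sub>n\<close> for that of \<open>\<E>\<^sub>N\<close>. It suffices that
  \<open>E (S\<^sub>N - \<E>\<^sub>N)\<^sup>2 = O(\<E>\<^sub>N + 1)\<close>: then \<open>S\<^sub>N / \<E>\<^sub>N \<rightarrow> 1\<close> almost surely along
  \<open>N\<^sub>k = min {N. \<E>\<^sub>N \<ge> (k + 1)\<^sup>2}\<close>, and monotonicity together with \<open>p\<^sub>n \<le> 1\<close> fills the gaps.

  For the second moment one shows \<open>\<bar>E X\<^sub>m X\<^sub>n - p\<^sub>n E X\<^sub>m\<bar> \<le> f(\<kappa>) E X\<^sub>m\<close> with a summable \<open>f\<close>, where \<open>\<kappa>\<close>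
  is the least of the distances \<open>\<bar>q\<^sub>i(m) - q\<^sub>j(n)\<bar>\<close> and \<open>\<bar>q\<^sub>i(n) - q\<^sub>j(n)\<bar>\<close>. By condition (a) every value of
  \<open>\<kappa>\<close> arises from boundedly many \<open>n\<close>, so the errors sum to \<open>O(1)\<close> for each \<open>m\<close>. If \<open>\<Lambda>\<^sub>n\<close> is short
  compared with \<open>\<kappa>\<close>, all translates of \<open>\<Lambda>\<^sub>n\<close> are far apart from each other and from those of
  \<open>\<Lambda>\<^sub>m\<close>, and mixing applies directly. If \<open>\<Lambda>\<^sub>n\<close> is long, then by (b) and nesting the end of its
  rightmost translate lies far to the right of everything in \<open>X\<^sub>m\<close>, and both terms are small
  because probabilities of cylinders decay exponentially with their length.
\<close>

section \<open>A second moment criterion\<close>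

text \<open>If \<open>(k + 1)\<^sup>2 \<le> e n < (k + 2)\<^sup>2\<close>, then
  \<open>N k \<le> n < N (Suc k)\<close>. Monotonicity traps \<open>s n / e n\<close> between the
  ratios at these two indices, up to factors that tend to 1 because consecutive squares are
  asymptotically equal.\<close>

lemma ratio_tendsto_one_interpolate:
  fixes s e :: "nat \<Rightarrow> real" and N :: "nat \<Rightarrow> nat"
  assumes s_mono: "mono s" and s_nonneg: "\<And>n. 0 \<le> s n"
    and e_mono: "mono e" and e_top: "filterlim e at_top sequentially"
    and N_ge: "\<And>k. (real k + 1)\<^sup>2 \<le> e (N k)"
    and N_le: "\<And>k. e (N k) \<le> (real k + 1)\<^sup>2 + 1"
    and N_least: "\<And>k n. n < N k \<Longrightarrow> e n < (real k + 1)\<^sup>2"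
    and lim: "(\<lambda>k. s (N k) / e (N k)) \<longlonglongrightarrow> 1"
  shows "(\<lambda>n. s n / e n) \<longlonglongrightarrow> 1"
proof -
  define r where "r k = s (N k) / e (N k)" for k
  \<comment> \<open>The numerator carries \<open>+ 1\<close> because \<open>e\<close> may overshoot
    the square by up to 1 at \<open>N (Suc k)\<close>.\<close>
  define U where "U k = r (Suc k) * (((real k + 2)\<^sup>2 + 1) / (real k + 1)\<^sup>2)" for k
  define L where "L k = r k * ((real k + 1)\<^sup>2 / (real k + 2)\<^sup>2)" for k
  \<comment> \<open>For \<open>1 \<le> e n\<close> this is the \<open>k\<close> with
    \<open>(k + 1)\<^sup>2 \<le> e n < (k + 2)\<^sup>2\<close>. Smaller values of \<open>e n\<close>
    occur only for finitely many \<open>n\<close>, so truncation at 0 is harmless.\<close>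
  define \<kappa> where "\<kappa> n = nat \<lfloor>sqrt (e n)\<rfloor> - 1" for n
  have r: "r \<longlonglongrightarrow> 1"
    using lim unfolding r_def .
  have \<kappa>: "filterlim \<kappa> at_top sequentially"
  proof -
    have a: "filterlim (\<lambda>x::real. nat \<lfloor>sqrt x\<rfloor> - 1) at_top at_top"
      unfolding filterlim_at_top
    proof
      fix Z :: nat
      show "eventually (\<lambda>x::real. Z \<le> nat \<lfloor>sqrt x\<rfloor> - 1) at_top"
      proof (rule eventually_mono[OF eventually_ge_at_top[of "(real Z + 1)\<^sup>2"]])
        fix x assume "(real Z + 1)\<^sup>2 \<le> x"
        then have "real Z + 1 \<le> sqrt x"
          by (simp add: real_le_rsqrt)
        then have "int Z + 1 \<le> \<lfloor>sqrt x\<rfloor>"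
          by (simp add: le_floor_iff)
        then show "Z \<le> nat \<lfloor>sqrt x\<rfloor> - 1"
          by linarith
      qed
    qed
    show ?thesis
      unfolding \<kappa>_def by (rule filterlim_compose[OF a e_top])
  qed
  have "(\<lambda>k. ((real k + 2)\<^sup>2 + 1) / (real k + 1)\<^sup>2) \<longlonglongrightarrow> 1"
    by real_asymp
  then have U: "U \<longlonglongrightarrow> 1"
    unfolding U_def using tendsto_mult[OF LIMSEQ_Suc[OF r]] by fastforce
  have "(\<lambda>k. (real k + 1)\<^sup>2 / (real k + 2)\<^sup>2) \<longlonglongrightarrow> 1"
    by real_asymp
  then have L: "L \<longlonglongrightarrow> 1"
    unfolding L_def using tendsto_mult[OF r] by fastforce
  have bounds: "L (\<kappa> n) \<le> s n / e n \<and> s n / e n \<le> U (\<kappa> n)" if "1 \<le> e n" for n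
  proof -
    have "1 \<le> sqrt (e n)"
      using that by simp
    then have fl: "1 \<le> \<lfloor>sqrt (e n)\<rfloor>"
      by (simp add: le_floor_iff)
    then have k: "real (\<kappa> n) + 1 = of_int \<lfloor>sqrt (e n)\<rfloor>"
      unfolding \<kappa>_def using that by (simp add: of_nat_diff le_nat_iff)
    have "real (\<kappa> n) + 1 \<le> sqrt (e n)" "sqrt (e n) < real (\<kappa> n) + 2"
      using k by linarith+
    then have "(real (\<kappa> n) + 1)\<^sup>2 \<le> (sqrt (e n))\<^sup>2"
      by (intro power_mono) auto
    moreover have "(sqrt (e n))\<^sup>2 < (real (\<kappa> n) + 2)\<^sup>2"
      by (rule power_strict_mono) (use \<open>sqrt (e n) < real (\<kappa> n) + 2\<close> that in simp_all)
    ultimately have sq: "(real (\<kappa> n) + 1)\<^sup>2 \<le> e n" "e n < (real (\<kappa> n) + 2)\<^sup>2"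
      using that by simp_all
    have pos: "0 < (real (\<kappa> n) + 1)\<^sup>2" "0 < (real (\<kappa> n) + 2)\<^sup>2"
      by (simp_all add: add_nonneg_pos)
    have epos: "0 < e (N k)" for k
      using N_ge[of k] by (smt (verit) of_nat_0_le_iff zero_less_power)
    have "N (\<kappa> n) \<le> n"
      using N_least[of n "\<kappa> n"] sq by (meson leD leI)
    then have 1: "s (N (\<kappa> n)) \<le> s n"
      using s_mono by (rule monoD[rotated])
    have "n < N (Suc (\<kappa> n))"
    proof (rule ccontr)
      assume "\<not> n < N (Suc (\<kappa> n))"
      then have "e (N (Suc (\<kappa> n))) \<le> e n"
        using e_mono by (simp add: monoD)
      then show False
        using N_ge[of "Suc (\<kappa> n)"] sq(2) by (simp add: add.commute)
    qed
    then have 2: "s n \<le> s (N (Suc (\<kappa> n)))"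
      using s_mono by (simp add: monoD)
    have 3: "s (N k) = r k * e (N k)" "0 \<le> r k" for k
      using epos[of k] s_nonneg by (simp_all add: r_def)
    have "s n / e n \<le> s (N (Suc (\<kappa> n))) / (real (\<kappa> n) + 1)\<^sup>2"
      using 2 sq(1) pos s_nonneg[of n] by (intro frac_le) auto
    also have "\<dots> \<le> r (Suc (\<kappa> n)) * ((real (\<kappa> n) + 2)\<^sup>2 + 1) / (real (\<kappa> n) + 1)\<^sup>2"
      unfolding 3(1) using N_le[of "Suc (\<kappa> n)"]
      by (intro divide_right_mono mult_left_mono 3(2)) (simp_all add: add.commute)
    finally have up: "s n / e n \<le> U (\<kappa> n)"
      by (simp add: U_def)
    have "L (\<kappa> n) \<le> s (N (\<kappa> n)) / (real (\<kappa> n) + 2)\<^sup>2"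
      unfolding L_def 3(1) using N_ge[of "\<kappa> n"] 3(2)[of "\<kappa> n"]
      by (simp add: divide_right_mono mult_left_mono)
    also have "\<dots> \<le> s n / e n"
      using 1 sq that s_nonneg pos by (intro frac_le) auto
    finally show ?thesis
      using up by simp
  qed
  have ev: "eventually (\<lambda>n. 1 \<le> e n) sequentially"
    using e_top by (simp add: filterlim_at_top)
  show ?thesis
  proof (rule tendsto_sandwich)
    show "(\<lambda>n. L (\<kappa> n)) \<longlonglongrightarrow> 1" "(\<lambda>n. U (\<kappa> n)) \<longlonglongrightarrow> 1"
      using filterlim_compose[OF L \<kappa>] filterlim_compose[OF U \<kappa>] .
  qed (use bounds ev in \<open>auto elim: eventually_mono\<close>)
qed

text \<open>Along \<open>N k\<close> the relative square errors have expectations of order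
  \<open>1 / (k + 1)\<^sup>2\<close>. Hence their series has finite expectation, converges almost
  surely, and its terms tend to 0; interpolation covers the other indices.\<close>

lemma (in prob_space) AE_tendsto_ratio_one:
  fixes S :: "nat \<Rightarrow> 'a \<Rightarrow> real" and e :: "nat \<Rightarrow> real"
  assumes S_meas [measurable]: "\<And>N. random_variable borel (S N)"
    and S_mono: "\<And>\<omega>. mono (\<lambda>N. S N \<omega>)" and S_nonneg: "\<And>N \<omega>. 0 \<le> S N \<omega>"
    and e_mono: "mono e" and e_0: "e 0 = 0" and e_step: "\<And>N. e (Suc N) \<le> e N + 1"
    and e_top: "filterlim e at_top sequentially"
    and int: "\<And>N. integrable M (\<lambda>\<omega>. (S N \<omega> - e N)\<^sup>2)"
    and second_moment: "\<And>N. expectation (\<lambda>\<omega>. (S N \<omega> - e N)\<^sup>2) \<le> c * (e N + 1)"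
  shows "AE \<omega> in M. (\<lambda>N. S N \<omega> / e N) \<longlonglongrightarrow> 1"
proof -
  define N where "N k = (LEAST n. (real k + 1)\<^sup>2 \<le> e n)" for k :: nat
  have ex: "\<exists>n. (real k + 1)\<^sup>2 \<le> e n" for k :: nat
    using e_top unfolding filterlim_at_top eventually_sequentially by blast
  have N_ge: "(real k + 1)\<^sup>2 \<le> e (N k)" for k
    unfolding N_def by (rule LeastI_ex[OF ex])
  have N_least: "e n < (real k + 1)\<^sup>2" if "n < N k" for n k
    using not_less_Least[of n] that unfolding N_def by fastforce
  have N_le: "e (N k) \<le> (real k + 1)\<^sup>2 + 1" for k
  \<comment> \<open>The predecessor of a least index is still below the square, and one step adds at
    most 1; at index 0 the bound is trivial.\<close>
  proof (cases "N k")
    case 0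
    then show ?thesis by (simp add: e_0 add_nonneg_nonneg)
  next
    case (Suc n)
    then show ?thesis
      using N_least[of n k] e_step[of n] by simp
  qed
  have N_ge1: "1 \<le> e (N k)" for k
    using N_ge[of k] by (smt (verit) of_nat_0_le_iff one_le_power)
  have c: "0 \<le> c"
  proof -
    have "0 \<le> expectation (\<lambda>\<omega>. (S 0 \<omega> - e 0)\<^sup>2)" by (rule Bochner_Integration.integral_nonneg) simp
    also have "\<dots> \<le> c" using second_moment[of 0] e_0 by simp
    finally show ?thesis .
  qed
  define Y where "Y k \<omega> = ((S (N k) \<omega> - e (N k)) / e (N k))\<^sup>2" for k \<omega>
  have [measurable]: "Y k \<in> borel_measurable M" for k
    unfolding Y_def by measurable
  have Y_int: "integrable M (Y k)" for k
    unfolding Y_def power_divide using int by simp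
  have Y_le: "expectation (Y k) \<le> 2 * c / (real k + 1)\<^sup>2" for k
  proof -
    have "expectation (Y k) = expectation (\<lambda>\<omega>. (S (N k) \<omega> - e (N k))\<^sup>2) / (e (N k))\<^sup>2"
      unfolding Y_def power_divide by simp
    also have "\<dots> \<le> c * (e (N k) + 1) / (e (N k))\<^sup>2"
      using second_moment by (intro divide_right_mono) auto
    also have "\<dots> \<le> c * (2 * e (N k)) / (e (N k))\<^sup>2"
      using N_ge1[of k] c by (intro divide_right_mono mult_left_mono) auto
    also have "\<dots> = 2 * c / e (N k)"
      using N_ge1[of k] by (simp add: power2_eq_square)
    also have "\<dots> \<le> 2 * c / (real k + 1)\<^sup>2"
      using N_ge[of k] c by (intro divide_left_mono) (auto simp: zero_less_mult_iff add_nonneg_pos intro: order.strict_trans1 N_ge1 less_le_trans[OF zero_less_one])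
    finally show ?thesis .
  qed
  have summ: "summable (\<lambda>k. 2 * c / (real k + 1)\<^sup>2)"
    using summable_mult[OF iffD2[OF summable_Suc_iff inverse_power_summable[of 2, where 'a=real]], of "2 * c"]
    by (simp add: divide_inverse add.commute)
  have "(\<integral>\<^sup>+\<omega>. (\<Sum>k. ennreal (Y k \<omega>)) \<partial>M) = (\<Sum>k. \<integral>\<^sup>+\<omega>. ennreal (Y k \<omega>) \<partial>M)"
    by (rule nn_integral_suminf) measurable
  also have "\<dots> = (\<Sum>k. ennreal (expectation (Y k)))"
    by (subst nn_integral_eq_integral[OF Y_int]) (auto simp: Y_def)
  also have "\<dots> \<le> (\<Sum>k. ennreal (2 * c / (real k + 1)\<^sup>2))"
    by (intro suminf_le ennreal_leI Y_le summableI)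
  also have "\<dots> < \<infinity>"
    using summ c by (simp add: suminf_ennreal2 less_top)
  finally have "AE \<omega> in M. (\<Sum>k. ennreal (Y k \<omega>)) \<noteq> \<infinity>"
    by (intro nn_integral_noteq_infinite) auto
  then show ?thesis
  proof (rule AE_mp, intro AE_I2 impI)
    fix \<omega>
    assume "(\<Sum>k. ennreal (Y k \<omega>)) \<noteq> \<infinity>"
    then have "summable (\<lambda>k. Y k \<omega>)"
      by (intro summable_suminf_not_top) (auto simp: Y_def)
    then have "(\<lambda>k. sqrt (Y k \<omega>)) \<longlonglongrightarrow> sqrt 0"
      by (intro tendsto_real_sqrt summable_LIMSEQ_zero)
    then have "(\<lambda>k. (S (N k) \<omega> - e (N k)) / e (N k)) \<longlonglongrightarrow> 0"
      by (simp add: Y_def tendsto_rabs_zero_iff del: abs_divide)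
    then have "(\<lambda>k. (S (N k) \<omega> - e (N k)) / e (N k) + 1) \<longlonglongrightarrow> 0 + 1"
      by (intro tendsto_add tendsto_const)
    moreover have "(S (N k) \<omega> - e (N k)) / e (N k) + 1 = S (N k) \<omega> / e (N k)" for k
      using N_ge1[of k] by (simp add: field_simps)
    ultimately have "(\<lambda>k. S (N k) \<omega> / e (N k)) \<longlonglongrightarrow> 1"
      by simp
    then show "(\<lambda>N. S N \<omega> / e N) \<longlonglongrightarrow> 1"
      using ratio_tendsto_one_interpolate[where s = "\<lambda>n. S n \<omega>" and e = e and N = N]
        S_mono S_nonneg e_mono e_top N_ge N_le N_least by blast
  qed
qed

text \<open>The second moment is the sum over all pairs of \<open>(prob (A m \<inter> A n) - p n *
  prob (A m)) + p m * (p n - prob (A n))\<close>. For \<open>m < n\<close> the brackets are bounded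
  by \<open>pairs\<close> and \<open>singles\<close>. Summing over \<open>n\<close> leaves a
  constant times \<open>prob (A m)\<close> or \<open>p m\<close>, and these sum to
  \<open>O(e N + 1)\<close>.\<close>

lemma (in prob_space) AE_hits_ratio_one:
  fixes A :: "nat \<Rightarrow> 'a set" and p b :: "nat \<Rightarrow> real" and a :: "nat \<Rightarrow> nat \<Rightarrow> real"
  assumes A: "\<And>n. 1 \<le> n \<Longrightarrow> A n \<in> events"
    and p: "\<And>n. 1 \<le> n \<Longrightarrow> 0 \<le> p n" "\<And>n. 1 \<le> n \<Longrightarrow> p n \<le> 1"
    and pairs: "\<And>m n. 1 \<le> m \<Longrightarrow> m < n \<Longrightarrow> prob (A m \<inter> A n) - p n * prob (A m) \<le> a m n * prob (A m)"
    and singles: "\<And>n. 1 \<le> n \<Longrightarrow> \<bar>prob (A n) - p n\<bar> \<le> b n"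
    and a_sum: "\<And>m N. 1 \<le> m \<Longrightarrow> (\<Sum>n\<in>{m<..N}. a m n) \<le> B"
    and b_sum: "\<And>N. (\<Sum>n = 1..N. b n) \<le> B"
    and top: "filterlim (\<lambda>N. \<Sum>n = 1..N. p n) at_top sequentially"
  shows "AE \<omega> in M. (\<lambda>N. (\<Sum>n = 1..N. indicator (A n) \<omega>) / (\<Sum>n = 1..N. p n)) \<longlonglongrightarrow> 1"
proof -
  define e where "e N = (\<Sum>n = 1..N. p n)" for N
  define S where "S N \<omega> = (\<Sum>n = 1..N. indicator (A n) \<omega> :: real)" for N \<omega>
  define t where "t m n = prob (A m \<inter> A n) - p n * prob (A m) - p m * prob (A n) + p m * p n" for m n
  \<comment> \<open>On the diagonal 1 suffices, since the intersection is then \<open>A m\<close>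
    itself.\<close>
  define a' where "a' m n = (if m = n then 1 else if m < n then a m n else 0)" for m n
  \<comment> \<open>A majorant supported on \<open>m \<le> n\<close>. Its symmetrisation dominates
    \<open>t\<close>; the diagonal is counted twice, which does no harm as \<open>u m m\<close> is
    nonnegative.\<close>
  define u where "u m n = (if m \<le> n then prob (A m) * a' m n + p m * b n else 0)" for m n
  have B: "0 \<le> B" using b_sum[of 0] by simp
  have e_nonneg: "0 \<le> e N" for N
    unfolding e_def using p by (intro sum_nonneg) auto
  define g where "g m n \<omega> = indicator (A m \<inter> A n) \<omega> - p n * indicator (A m) \<omega> - p m * indicator (A n) \<omega> + p m * p n"
    for m n \<omega>
  have expand: "(S N \<omega> - e N)\<^sup>2 = (\<Sum>m = 1..N. \<Sum>n = 1..N. g m n \<omega>)" for N \<omega>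
    unfolding S_def e_def g_def power2_eq_square sum_subtractf[symmetric] sum_product
    by (intro sum.cong refl) (simp add: indicator_inter_arith algebra_simps)
  have int1: "integrable M (indicator (A m) :: 'a \<Rightarrow> real)" if "1 \<le> m" for m
    using A[OF that] by (simp add: emeasure_eq_measure)
  have int2: "integrable M (indicator (A m \<inter> A n) :: 'a \<Rightarrow> real)" if "1 \<le> m" "1 \<le> n" for m n
    using A[OF that(1)] A[OF that(2)] by (intro integrable_real_indicator sets.Int) (auto simp: emeasure_eq_measure)
  have int_g: "integrable M (g m n)" if "1 \<le> m" "1 \<le> n" for m n
    unfolding g_def by (intro Bochner_Integration.integrable_add Bochner_Integration.integrable_diff
      integrable_mult_right integrable_const int1 int2 that)
  have int: "integrable M (\<lambda>\<omega>. (S N \<omega> - e N)\<^sup>2)" for N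
    unfolding expand by (intro Bochner_Integration.integrable_sum int_g) auto
  have exp_g: "expectation (g m n) = t m n" if "1 \<le> m" "1 \<le> n" for m n
  proof -
    have "A m \<inter> space M = A m" "A n \<inter> space M = A n" "A m \<inter> A n \<inter> space M = A m \<inter> A n"
      using A[OF that(1)] A[OF that(2)] sets.sets_into_space by blast+
    then show ?thesis
      using int1[OF that(1)] int1[OF that(2)] int2[OF that]
      by (simp add: t_def g_def[abs_def] prob_space)
  qed
  have E: "expectation (\<lambda>\<omega>. (S N \<omega> - e N)\<^sup>2) = (\<Sum>m = 1..N. \<Sum>n = 1..N. t m n)" for N
  proof -
    have "expectation (\<lambda>\<omega>. (S N \<omega> - e N)\<^sup>2) = (\<Sum>m = 1..N. expectation (\<lambda>\<omega>. \<Sum>n = 1..N. g m n \<omega>))"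
      unfolding expand
      by (rule Bochner_Integration.integral_sum) (intro Bochner_Integration.integrable_sum int_g; simp)
    also have "\<dots> = (\<Sum>m = 1..N. \<Sum>n = 1..N. expectation (g m n))"
      by (intro sum.cong refl Bochner_Integration.integral_sum int_g) auto
    finally show ?thesis
      using exp_g by simp
  qed
  have t_le: "t m n \<le> u m n + u n m" if "1 \<le> m" "1 \<le> n" for m n
  proof -
    have *: "t m n \<le> u m n" if "1 \<le> m" "m \<le> n" for m n
    proof -
      have "prob (A m \<inter> A n) - p n * prob (A m) \<le> prob (A m) * a' m n"
        using pairs[of m n] p(1)[of n] that by (auto simp: a'_def mult.commute)
      moreover have "p m * (p n - prob (A n)) \<le> p m * b n"
        using singles[of n] p(1)[of m] that by (intro mult_left_mono) auto
      ultimately show ?thesis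
        using that by (simp add: t_def u_def algebra_simps)
    qed
    have sym: "t m n = t n m" for m n
      by (simp add: t_def Int_commute mult.commute)
    have u0: "u m m \<ge> 0" if "1 \<le> m" for m
      using p(1)[of m] singles[of m] that by (auto simp: u_def a'_def)
    consider "m < n" | "n < m" | "m = n" by linarith
    then show ?thesis
    proof cases
      case 1
      then show ?thesis using *[of m n] that by (simp add: u_def)
    next
      case 2
      then show ?thesis using *[of n m] that sym by (simp add: u_def)
    next
      case 3
      then show ?thesis using *[of m n] u0[of m] that by simp
    qed
  qed
  \<comment> \<open>Replacing \<open>prob (A m)\<close> by \<open>p m\<close> costs at most
    \<open>B\<close> in total.\<close>
  have P_sum: "(\<Sum>m = 1..N. prob (A m)) \<le> e N + B" for N
  proof -
    have "(\<Sum>m = 1..N. prob (A m)) \<le> (\<Sum>m = 1..N. p m + b m)"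
      using singles by (intro sum_mono) (auto simp: abs_le_iff field_simps)
    then show ?thesis using b_sum[of N] by (simp add: sum.distrib e_def)
  qed
  have u_sum: "(\<Sum>m = 1..N. \<Sum>n = 1..N. u m n) \<le> (2 * B + 1) * e N + B * (B + 1)" for N
  proof -
    have "(\<Sum>n = 1..N. u m n) \<le> prob (A m) * (B + 1) + p m * B" if m: "m \<in> {1..N}" for m
    proof -
      have a'_sum: "(\<Sum>n = m..N. a' m n) \<le> B + 1"
      proof -
        have "(\<Sum>n = m..N. a' m n) = 1 + (\<Sum>n\<in>{m<..N}. a' m n)"
          using m by (simp add: sum.head a'_def)
        also have "(\<Sum>n\<in>{m<..N}. a' m n) = (\<Sum>n\<in>{m<..N}. a m n)"
          by (intro sum.cong) (auto simp: a'_def)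
        finally show ?thesis
          using m a_sum[of m N] by simp
      qed
      have "(\<Sum>n = m..N. b n) \<le> (\<Sum>n = 1..N. b n)"
      proof (rule sum_mono2)
        show "0 \<le> b n" if "n \<in> {1..N} - {m..N}" for n
          using order_trans[OF abs_ge_zero singles[of n]] that by auto
      qed (use m in auto)
      then have b_le: "(\<Sum>n = m..N. b n) \<le> B"
        using b_sum[of N] by linarith
      have "(\<Sum>n = 1..N. u m n) = (\<Sum>n = m..N. u m n)"
        using m by (intro sum.mono_neutral_right) (auto simp: u_def)
      also have "\<dots> = prob (A m) * (\<Sum>n = m..N. a' m n) + p m * (\<Sum>n = m..N. b n)"
        by (simp add: u_def sum.distrib sum_distrib_left)
      also have "\<dots> \<le> prob (A m) * (B + 1) + p m * B"
        using m p(1)[of m] by (intro add_mono mult_left_mono a'_sum b_le) auto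
      finally show ?thesis .
    qed
    then have "(\<Sum>m = 1..N. \<Sum>n = 1..N. u m n) \<le> (\<Sum>m = 1..N. prob (A m) * (B + 1) + p m * B)"
      by (rule sum_mono)
    also have "\<dots> = (\<Sum>m = 1..N. prob (A m)) * (B + 1) + e N * B"
      by (simp add: sum.distrib sum_distrib_right e_def)
    also have "\<dots> \<le> (e N + B) * (B + 1) + e N * B"
      using P_sum B by (intro add_right_mono mult_right_mono) auto
    finally show ?thesis by (simp add: algebra_simps)
  qed
  have second_moment: "expectation (\<lambda>\<omega>. (S N \<omega> - e N)\<^sup>2) \<le> 2 * (B + 1)\<^sup>2 * 2 * (e N + 1)" for N
  proof -
    have "expectation (\<lambda>\<omega>. (S N \<omega> - e N)\<^sup>2) \<le> (\<Sum>m = 1..N. \<Sum>n = 1..N. u m n + u n m)"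
      unfolding E by (intro sum_mono t_le) auto
    also have "\<dots> = 2 * (\<Sum>m = 1..N. \<Sum>n = 1..N. u m n)"
      unfolding sum.distrib by (subst (2) sum.swap) simp
    also have "\<dots> \<le> 2 * ((2 * B + 1) * e N + B * (B + 1))"
      by (intro mult_left_mono u_sum) auto
    also have "\<dots> \<le> 2 * ((2 * (B + 1)\<^sup>2) * e N + 2 * (B + 1)\<^sup>2)"
      using B e_nonneg[of N]
      by (intro mult_left_mono add_mono mult_right_mono) (auto simp: power2_eq_square algebra_simps)
    finally show ?thesis by (simp add: algebra_simps)
  qed
  have "AE \<omega> in M. (\<lambda>N. S N \<omega> / e N) \<longlonglongrightarrow> 1"
  proof (rule AE_tendsto_ratio_one[OF _ _ _ _ _ _ _ int second_moment])
    show "S N \<in> borel_measurable M" for N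
      unfolding S_def using A by (intro borel_measurable_sum borel_measurable_indicator) auto
    show "mono (\<lambda>N. S N \<omega>)" for \<omega>
      unfolding S_def by (intro monoI sum_mono2) auto
    show "0 \<le> S N \<omega>" for N \<omega>
      unfolding S_def by (intro sum_nonneg) auto
    show "mono e"
      unfolding e_def using p by (intro monoI sum_mono2) auto
    show "e (Suc N) \<le> e N + 1" for N
      using p(2)[of "Suc N"] by (simp add: e_def)
    show "filterlim e at_top sequentially"
      using top by (simp add: e_def[abs_def])
  qed (simp add: e_def)
  then show ?thesis
    by (simp add: S_def e_def)
qed

section \<open>Cylinder events and mixing\<close>

text \<open>Grouping the indices by the value of \<open>h\<close> makes each \<open>f k\<close>
  occur at most \<open>M\<close> times. This is how counting conditions on \<open>q\<close> become
  bounds on sums of errors.\<close>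

lemma sum_comp_le:
  fixes f :: "nat \<Rightarrow> real"
  assumes f: "summable f" "\<And>k. 0 \<le> f k" and F: "finite F"
    and fibre: "\<And>k. card {n \<in> F. h n = k} \<le> M"
  shows "(\<Sum>n\<in>F. f (h n)) \<le> real M * suminf f"
proof -
  have "(\<Sum>n\<in>F. f (h n)) = (\<Sum>k\<in>h ` F. \<Sum>n | n \<in> F \<and> h n = k. f (h n))"
    by (rule sum.image_gen[OF F])
  also have "\<dots> = (\<Sum>k\<in>h ` F. real (card {n \<in> F. h n = k}) * f k)"
    by (intro sum.cong refl) simp
  also have "\<dots> \<le> (\<Sum>k\<in>h ` F. real M * f k)"
    using fibre f by (intro sum_mono mult_right_mono) auto
  also have "\<dots> = real M * (\<Sum>k\<in>h ` F. f k)"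
    by (simp add: sum_distrib_left)
  also have "\<dots> \<le> real M * suminf f"
    using f F by (intro mult_left_mono sum_le_suminf) auto
  finally show ?thesis .
qed

text \<open>Serves reindexings such as \<open>t div d\<close>, whose fibres lie in windows of a
  fixed length.\<close>

lemma summable_comp_fibre:
  fixes f :: "nat \<Rightarrow> real" and h :: "nat \<Rightarrow> nat"
  assumes f: "summable f" "\<And>k. 0 \<le> f k"
    and fibre: "\<And>k. {n. h n = k} \<subseteq> {c k..<c k + M}"
  shows "summable (\<lambda>n. f (h n))"
proof (rule summableI_nonneg_bounded)
  show "(\<Sum>i<n. f (h i)) \<le> real M * suminf f" for n
  proof (rule sum_comp_le[OF f])
    show "card {i \<in> {..<n}. h i = k} \<le> M" for k
      using card_mono[of "{c k..<c k + M}" "{i \<in> {..<n}. h i = k}"] fibre[of k] by auto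
  qed simp
qed (use f in auto)

text \<open>Cylinder events are encoded by finite sets of pairs (coordinate, letter), so that
  intersections of events become unions and splitting an event by position becomes filtering.\<close>

definition fixing :: "(int \<times> 'a) set \<Rightarrow> (int \<Rightarrow> 'a) set" where
  "fixing W = {\<omega>. \<forall>(i, a)\<in>W. \<omega> i = a}"

text \<open>The letters are read at the untranslated positions, so that translating a cylinder
  changes \<open>s\<close> and leaves \<open>a\<close> as it is.\<close>

definition block :: "(int \<Rightarrow> 'a) \<Rightarrow> int \<Rightarrow> int \<Rightarrow> int \<Rightarrow> (int \<times> 'a) set" where
  "block a s u v = (\<lambda>t. (t + s, a t)) ` {u..v}"

lemma fixing_empty [simp]: "fixing {} = UNIV"
  by (simp add: fixing_def)

lemma fixing_Un: "fixing (V \<union> W) = fixing V \<inter> fixing W"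
  unfolding fixing_def ball_Un by (rule Collect_conj_eq)

lemma fixing_insert: "fixing (insert x W) = fixing {x} \<inter> fixing W"
  by (auto simp: fixing_def)

lemma fixing_UN: "fixing (\<Union>i\<in>I. W i) = (\<Inter>i\<in>I. fixing (W i))"
  by (auto simp: fixing_def)

lemma fixing_antimono: "V \<subseteq> W \<Longrightarrow> fixing W \<subseteq> fixing V"
  by (auto simp: fixing_def)

lemma finite_block [simp]: "finite (block a s u v)"
  by (simp add: block_def)

lemma cylinder_on_eq_block:
  "cylinder_on l r C \<longleftrightarrow> l \<le> r \<and> (\<exists>a. C = fixing (block a 0 l r))"
  by (simp add: cylinder_on_def fixing_def block_def)

lemma left_shift_funpow: "(left_shift ^^ k) \<omega> = (\<lambda>i. \<omega> (i + int k))"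
  by (induction k arbitrary: \<omega>) (auto simp: left_shift_def algebra_simps funpow_swap1)

lemma left_shift_in_fixing_block:
  "(left_shift ^^ k) \<omega> \<in> fixing (block a s u v) \<longleftrightarrow> \<omega> \<in> fixing (block a (s + int k) u v)"
  by (simp add: left_shift_funpow fixing_def block_def add.assoc)

text \<open>Admits these events in the suprema that define the dependence coefficients.\<close>

lemma fixing_in_coord_algebra:
  assumes "finite W" "\<And>i a. (i, a) \<in> W \<Longrightarrow> i \<in> I"
  shows "fixing W \<in> coord_algebra I"
  using assms
proof (induction W)
  case empty
  then show ?case by (simp add: coord_algebra_def sigma_sets_top)
next
  case (insert x W)
  interpret sigma_algebra UNIV "coord_algebra I"
    unfolding coord_algebra_def by (rule sigma_algebra_sigma_sets) simp
  obtain i a where x: "x = (i, a)" by (cases x)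
  have "fixing {x} = (\<lambda>\<omega>. \<omega> i) -` {a}"
    by (auto simp: fixing_def x)
  then have "fixing {x} \<in> coord_algebra I"
    using insert.prems[of i a] unfolding coord_algebra_def x by (intro sigma_sets.Basic) auto
  then show ?case
    using insert.IH insert.prems unfolding fixing_insert[of x W] by (intro Int) auto
qed

section \<open>Stationary measures on the shift space\<close>

locale shift_process = prob_space P for P :: "(int \<Rightarrow> 'a::countable) measure" +
  assumes sets_P: "sets P = sets full_shift_space"
    and invariant: "shift_invariant P"
begin

abbreviation pr :: "(int \<times> 'a) set \<Rightarrow> real" where
  "pr W \<equiv> measure P (fixing W)"

lemma space_P [simp]: "space P = UNIV"
  using sets_eq_imp_space_eq[OF sets_P] by (simp add: full_shift_space_def)

lemma fixing_measurable [simp]: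
  assumes "finite W"
  shows "fixing W \<in> events"
  using assms
proof (induction W)
  case empty
  then show ?case by (metis fixing_empty sets.top space_P)
next
  case (insert x W)
  obtain i a where x: "x = (i, a)" by (cases x)
  have "cylinder_on i i (fixing {x})"
    by (auto simp: cylinder_on_def fixing_def x intro!: exI[of _ "\<lambda>_. a"])
  then have "fixing {x} \<in> events"
    unfolding sets_P full_shift_space_def by (auto intro: sigma_sets.Basic)
  then show ?case
    using insert.IH unfolding fixing_insert[of x W] by (intro sets.Int) auto
qed

lemma prob_UNIV [simp]: "prob UNIV = 1"
  using prob_space by simp

lemma pr_antimono: "finite V \<Longrightarrow> V \<subseteq> W \<Longrightarrow> pr W \<le> pr V"
  by (intro finite_measure_mono fixing_antimono) auto

lemma pr_vimage_shift:
  assumes "A \<in> events"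
  shows "measure P ((left_shift ^^ k) -` A) = measure P A"
  using assms
proof (induction k arbitrary: A)
  case (Suc k)
  have meas: "left_shift \<in> measurable P P" and distr: "distr P P left_shift = P"
    using invariant by (auto simp: shift_invariant_def)
  have A: "left_shift -` A \<in> events"
    using measurable_sets[OF meas Suc.prems] by simp
  have "measure P (left_shift -` A) = measure (distr P P left_shift) A"
    using measure_distr[OF meas Suc.prems] by simp
  then show ?case
    using Suc.IH[OF A] by (simp add: distr vimage_comp o_def)
qed simp

lemma pr_block_shift: "pr (block a (s + int k) u v) = pr (block a s u v)"
proof -
  have "fixing (block a (s + int k) u v) = (left_shift ^^ k) -` fixing (block a s u v)"
    by (auto simp: left_shift_in_fixing_block)
  then show ?thesis
    by (simp add: pr_vimage_shift)
qed

lemma pr_letter: "pr {(i, a)} = measure P {\<omega>. \<omega> 0 = a}"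
proof -
  have *: "{(t, a)} = block (\<lambda>_. a) t 0 0" for t
    by (auto simp: block_def)
  have "pr {(i, a)} = pr {(0, a)}"
  \<comment> \<open>Invariance is applied to nonnegative powers of the shift, so a negative position
    is moved up to 0 instead of the other way round.\<close>
  proof (cases "0 \<le> i")
    case True
    then show ?thesis
      using pr_block_shift[of "\<lambda>_. a" 0 "nat i" 0 0] unfolding * by simp
  next
    case False
    then show ?thesis
      using pr_block_shift[of "\<lambda>_. a" i "nat (- i)" 0 0] unfolding * by simp
  qed
  then show ?thesis
    by (simp add: fixing_def)
qed

end

section \<open>One-sided mixing and the decay of cylinder probabilities\<close>

text \<open>The abstract rate \<open>\<alpha>\<close> stands for either coefficient sequence, so
  that the decay of cylinders and the estimates for long cylinders are proved once for both
  cases.\<close>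

locale phi_mixing_shift = shift_process P for P :: "(int \<Rightarrow> 'a::countable) measure" +
  fixes \<alpha> :: "nat \<Rightarrow> real"
  assumes alphabet: "\<exists>a b :: 'a. a \<noteq> b"
    and letters: "\<And>a :: 'a. measure P {\<omega>. \<omega> 0 = a} > 0"
    and \<alpha>_nonneg: "\<And>k. 0 \<le> \<alpha> k" and \<alpha>_summable: "summable \<alpha>"
    and phi_mixing: "\<And>k x Z V. 1 \<le> k \<Longrightarrow> finite Z \<Longrightarrow> finite V \<Longrightarrow>
      (\<And>i a. (i, a) \<in> Z \<Longrightarrow> i \<le> x) \<Longrightarrow> (\<And>i a. (i, a) \<in> V \<Longrightarrow> x + int k \<le> i) \<Longrightarrow>
      \<bar>pr (Z \<union> V) - pr Z * pr V\<bar> \<le> \<alpha> k * pr Z"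
begin

text \<open>Fix two letters of positive probability. Every letter differs from one of them and so
  misses at least the smaller of their masses; this is uniform even over an infinite
  alphabet.\<close>

lemma pr_letter_bound:
  obtains \<theta> where "\<theta> < 1" "\<And>i a. pr {(i, a)} \<le> \<theta>"
proof -
  obtain u v :: 'a where uv: "u \<noteq> v" using alphabet by blast
  define \<theta> where "\<theta> = 1 - min (pr {(0, u)}) (pr {(0, v)})"
  have two: "pr {(i, a)} + pr {(0, b)} \<le> 1" if "a \<noteq> b" for i a b
  proof -
    have "pr {(0, a)} + pr {(0, b)} = measure P (fixing {(0, a)} \<union> fixing {(0, b)})"
    proof (intro finite_measure_Union[symmetric] fixing_measurable)
      show "fixing {(0, a)} \<inter> fixing {(0, b)} = {}" using that by (auto simp: fixing_def)
    qed auto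
    then show ?thesis using pr_letter[of i a] pr_letter[of 0 a] by simp
  qed
  show ?thesis
  proof
    show "\<theta> < 1" using letters[of u] letters[of v] by (simp add: \<theta>_def pr_letter)
    fix i a
    have "a \<noteq> u \<or> a \<noteq> v" using uv by blast
    then show "pr {(i, a)} \<le> \<theta>"
    proof
      assume "a \<noteq> u"
      from two[OF this, of i] show ?thesis by (simp add: \<theta>_def min_def)
    next
      assume "a \<noteq> v"
      from two[OF this, of i] show ?thesis by (simp add: \<theta>_def min_def)
    qed
  qed
qed

text \<open>Keep only every \<open>d\<close>-th letter of the block, where \<open>d\<close> is so
  large that \<open>\<theta> + \<alpha> d < 1\<close>. By mixing across a gap \<open>d\<close>, each
  further letter multiplies the probability by at most this number.\<close>

lemma block_decay:
  obtains \<epsilon> where "summable \<epsilon>" "\<And>t. 0 \<le> \<epsilon> t"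
    "\<And>a s u v t. int t \<le> v - u + 1 \<Longrightarrow> pr (block a s u v) \<le> \<epsilon> t"
proof -
  obtain \<theta> where \<theta>: "\<theta> < 1" "\<And>i a. pr {(i, a)} \<le> \<theta>"
    using pr_letter_bound by blast
  have "\<alpha> \<longlonglongrightarrow> 0" by (rule summable_LIMSEQ_zero[OF \<alpha>_summable])
  then have "eventually (\<lambda>k. \<alpha> k < 1 - \<theta>) sequentially"
    using \<theta>(1) by (simp add: order_tendstoD)
  then have "eventually (\<lambda>k. \<alpha> k < 1 - \<theta> \<and> 1 \<le> k) sequentially"
    using eventually_ge_at_top[of "1::nat"] by eventually_elim simp
  then obtain d where d: "\<alpha> d < 1 - \<theta>" "1 \<le> d"
    unfolding eventually_sequentially by blast
  define r where "r = \<theta> + \<alpha> d"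
  have \<theta>0: "0 \<le> \<theta>" using \<theta>(2)[of 0 undefined] measure_nonneg order_trans by blast
  have r: "0 \<le> r" "r < 1" using d \<theta>0 \<alpha>_nonneg[of d] by (auto simp: r_def)
  define Q where "Q a s u n = (\<lambda>i. (u + int i * int d + s, a (u + int i * int d))) ` {..<n}"
    for a :: "int \<Rightarrow> 'a" and s u :: int and n :: nat
  have Q: "pr (Q a s u n) \<le> r ^ n" for a s u n
  proof (induction n)
    case 0
    then show ?case by (simp add: Q_def)
  next
    case (Suc n)
    let ?y = "(u + int n * int d + s, a (u + int n * int d))"
    have Q_Suc: "Q a s u (Suc n) = Q a s u n \<union> {?y}"
      by (auto simp: Q_def lessThan_Suc)
    have le: "i \<le> u + int n * int d + s - int d" if mem: "(i, c) \<in> Q a s u n" for i c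
    proof -
      obtain k where k: "k < n" "i = u + int k * int d + s"
        using mem by (auto simp: Q_def)
      then have "(int k + 1) * int d \<le> int n * int d"
        by (intro mult_right_mono) auto
      then show ?thesis using k by (simp add: algebra_simps)
    qed
    have "\<bar>pr (Q a s u n \<union> {?y}) - pr (Q a s u n) * pr {?y}\<bar> \<le> \<alpha> d * pr (Q a s u n)"
    proof (rule phi_mixing)
      show "i \<le> u + int n * int d + s - int d" if "(i, c) \<in> Q a s u n" for i c
        by (rule le[OF that])
      show "u + int n * int d + s - int d + int d \<le> i" if "(i, c) \<in> {?y}" for i c
        using that by simp
    qed (use d in \<open>auto simp: Q_def\<close>)
    then have "pr (Q a s u (Suc n)) \<le> pr (Q a s u n) * pr {?y} + \<alpha> d * pr (Q a s u n)"
      unfolding Q_Suc by linarith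
    also have "\<dots> \<le> pr (Q a s u n) * \<theta> + \<alpha> d * pr (Q a s u n)"
      using \<theta>(2) by (intro add_right_mono mult_left_mono) auto
    also have "\<dots> = pr (Q a s u n) * r" by (simp add: r_def algebra_simps)
    also have "\<dots> \<le> r ^ n * r" using Suc r by (intro mult_right_mono) auto
    finally show ?case by (simp add: mult.commute)
  qed
  show ?thesis
  proof
    show "summable (\<lambda>t. r ^ (t div d))"
    proof (rule summable_comp_fibre[where c = "\<lambda>k. k * d" and M = d])
      show "summable (\<lambda>t. r ^ t)" using r by (intro summable_geometric) auto
      show "{n. n div d = k} \<subseteq> {k * d..<k * d + d}" for k
      proof
        fix n assume "n \<in> {n. n div d = k}"
        then show "n \<in> {k * d..<k * d + d}"
          using d div_times_less_eq_dividend[of n d] dividend_less_div_times[of d n] by auto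
      qed
    qed (use r in auto)
    show "0 \<le> r ^ (t div d)" for t using r by simp
    fix a s u v t
    assume t: "int t \<le> v - u + 1"
    \<comment> \<open>The sampled offsets \<open>i * d\<close> with \<open>i < t div d\<close>
      satisfy \<open>(i + 1) * d \<le> t\<close>, so they stay inside the block.\<close>
    have "Q a s u (t div d) \<subseteq> block a s u v"
    proof -
      have "u + int i * int d \<in> {u..v}" if "i < t div d" for i
      proof -
        have "(i + 1) * d \<le> (t div d) * d" using that by (intro mult_right_mono) auto
        also have "\<dots> \<le> t" by simp
        finally have "int ((i + 1) * d) \<le> int t"
          by (simp only: of_nat_le_iff)
        then have "int i * int d + int d \<le> int t"
          by (simp add: algebra_simps)
        then show ?thesis using t d by auto
      qed
      then show ?thesis by (auto simp: Q_def block_def)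
    qed
    then have "pr (block a s u v) \<le> pr (Q a s u (t div d))"
      by (intro pr_antimono) (auto simp: Q_def)
    then show "pr (block a s u v) \<le> r ^ (t div d)" using Q order_trans by blast
  qed
qed

text \<open>Of \<open>V\<close> only the last \<open>j\<close> sites of the block are kept. They
  begin more than \<open>j\<close> to the right of \<open>Z\<close>, so mixing applies however much
  the rest of \<open>V\<close> overlaps \<open>Z\<close>.\<close>

lemma pr_Un_tail_le:
  assumes j: "1 \<le> j" and fin: "finite Z" "finite V"
    and Z: "\<And>i c. (i, c) \<in> Z \<Longrightarrow> i + 2 * int j \<le> v + s"
    and V: "block a s u v \<subseteq> V" and long: "int j \<le> v - u + 1"
    and decay: "pr (block a s (v - int j + 1) v) \<le> \<epsilon>"
  shows "pr (Z \<union> V) \<le> (\<alpha> j + \<epsilon>) * pr Z"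
proof -
  let ?B = "block a s (v - int j + 1) v"
  have sub: "?B \<subseteq> V" using V long by (force simp: block_def)
  have "\<bar>pr (Z \<union> ?B) - pr Z * pr ?B\<bar> \<le> \<alpha> j * pr Z"
    using j fin(1) by (intro phi_mixing[of j _ _ "v + s - 2 * int j"]) (force dest: Z simp: block_def)+
  moreover have "pr (Z \<union> V) \<le> pr (Z \<union> ?B)"
    using sub fin by (intro pr_antimono) auto
  ultimately have "pr (Z \<union> V) \<le> pr Z * pr ?B + \<alpha> j * pr Z"
    by linarith
  also have "\<dots> \<le> pr Z * \<epsilon> + \<alpha> j * pr Z"
    using decay by (intro add_right_mono mult_left_mono) auto
  finally show ?thesis by (simp add: algebra_simps)
qed

end

section \<open>Two-sided mixing with constraints on both sides\<close>

lemma abs_diff_le_add: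
  fixes x y z c d :: real
  shows "\<bar>x - y\<bar> \<le> c \<Longrightarrow> \<bar>y - z\<bar> \<le> d \<Longrightarrow> \<bar>x - z\<bar> \<le> c + d"
  by linarith

text \<open>Compare both \<open>y\<close> and \<open>b * w\<close> with
  \<open>t = z1 * b * z2\<close>. They differ from each other by at most
  \<open>(3 * \<alpha> + \<alpha>\<^sup>2) * t\<close>, which is at most
  \<open>7 / 2 * \<alpha> * t\<close>, and \<open>t \<le> 2 * (b * w)\<close> since
  \<open>\<alpha> \<le> 1 / 2\<close>; hence the constant 7.\<close>

lemma two_sided_product_estimate:
  fixes x y w z1 z2 b \<alpha> :: real
  assumes x: "\<bar>x - z1 * b\<bar> \<le> \<alpha> * (z1 * b)" and y: "\<bar>y - x * z2\<bar> \<le> \<alpha> * (x * z2)"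
    and w: "\<bar>w - z1 * z2\<bar> \<le> \<alpha> * (z1 * z2)"
    and nonneg: "0 \<le> z1" "0 \<le> z2" "0 \<le> b" "0 \<le> \<alpha>" and "\<alpha> \<le> 1 / 2"
  shows "\<bar>y - b * w\<bar> \<le> 7 * \<alpha> * (b * w)"
proof -
  define t where "t = z1 * b * z2"
  have t: "0 \<le> t" using nonneg by (simp add: t_def)
  have x1: "x * z2 \<le> (1 + \<alpha>) * t"
    using mult_right_mono[of x "(1 + \<alpha>) * (z1 * b)" z2] x nonneg by (simp add: t_def abs_le_iff algebra_simps)
  have x2: "(1 - \<alpha>) * t \<le> x * z2"
    using mult_right_mono[of "(1 - \<alpha>) * (z1 * b)" x z2] x nonneg by (simp add: t_def abs_le_iff algebra_simps)
  have w1: "b * w \<le> (1 + \<alpha>) * t"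
    using mult_left_mono[of w "(1 + \<alpha>) * (z1 * z2)" b] w nonneg by (simp add: t_def abs_le_iff algebra_simps)
  have w2: "(1 - \<alpha>) * t \<le> b * w"
    using mult_left_mono[of "(1 - \<alpha>) * (z1 * z2)" w b] w nonneg by (simp add: t_def abs_le_iff algebra_simps)
  have "y \<le> (1 + \<alpha>) * (x * z2)" using y by (simp add: abs_le_iff algebra_simps)
  also have "\<dots> \<le> (1 + \<alpha>) * ((1 + \<alpha>) * t)" using x1 nonneg by (intro mult_left_mono) auto
  finally have y1: "y \<le> (1 + \<alpha>) * ((1 + \<alpha>) * t)" .
  have "(1 - \<alpha>) * ((1 - \<alpha>) * t) \<le> (1 - \<alpha>) * (x * z2)" using x2 assms by (intro mult_left_mono) auto
  also have "\<dots> \<le> y" using y by (simp add: abs_le_iff algebra_simps)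
  finally have y2: "(1 - \<alpha>) * ((1 - \<alpha>) * t) \<le> y" .
  have at: "0 \<le> \<alpha> * t" "\<alpha> * (\<alpha> * t) \<le> 1 / 2 * (\<alpha> * t)" "0 \<le> \<alpha> * (\<alpha> * t)"
    using nonneg t mult_right_mono[OF assms(8), of "\<alpha> * t"] by auto
  have "\<alpha> * (1 / 2 * t) \<le> \<alpha> * ((1 - \<alpha>) * t)"
    using nonneg t assms(8) by (intro mult_left_mono mult_right_mono) auto
  also have "\<dots> \<le> \<alpha> * (b * w)"
    using w2 nonneg by (intro mult_left_mono) auto
  finally have "\<alpha> * t \<le> 2 * (\<alpha> * (b * w))" by simp
  moreover have "y \<le> t + 2 * (\<alpha> * t) + \<alpha> * (\<alpha> * t)" "t - 2 * (\<alpha> * t) + \<alpha> * (\<alpha> * t) \<le> y"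
    "b * w \<le> t + \<alpha> * t" "t - \<alpha> * t \<le> b * w"
    using y1 y2 w1 w2 by (simp_all add: algebra_simps)
  ultimately have "\<bar>y - b * w\<bar> \<le> 7 * (\<alpha> * (b * w))"
    using at by linarith
  then show ?thesis by (simp add: mult.assoc)
qed

locale psi_mixing_shift = phi_mixing_shift +
  assumes psi_mixing: "\<And>k x Z V. 1 \<le> k \<Longrightarrow> finite Z \<Longrightarrow> finite V \<Longrightarrow>
      (\<And>i a. (i, a) \<in> Z \<Longrightarrow> i \<le> x) \<Longrightarrow> (\<And>i a. (i, a) \<in> V \<Longrightarrow> x + int k \<le> i) \<Longrightarrow>
      \<bar>pr (Z \<union> V) - pr Z * pr V\<bar> \<le> \<alpha> k * (pr Z * pr V)"
begin

text \<open>The constraints in \<open>Z\<close> lie on both sides of \<open>B\<close>, so \<open>\<psi>\<close>-mixing is used three times: to split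
  off the right part of \<open>Z\<close>, to separate its left part from \<open>B\<close>, and to glue the two parts of
  \<open>Z\<close> together again.\<close>

lemma pr_Un_separated:
  assumes j: "1 \<le> j" "\<alpha> j \<le> 1 / 2" and fin: "finite Z" "finite B" and uv: "u \<le> v"
    and B: "\<And>i c. (i, c) \<in> B \<Longrightarrow> u \<le> i \<and> i \<le> v"
    and Z: "\<And>i c. (i, c) \<in> Z \<Longrightarrow> i + int j \<le> u \<or> v + int j \<le> i"
  shows "\<bar>pr (Z \<union> B) - pr B * pr Z\<bar> \<le> 7 * \<alpha> j * (pr B * pr Z)"
proof -
  define Z1 where "Z1 = {z \<in> Z. fst z + int j \<le> u}"
  define Z2 where "Z2 = {z \<in> Z. v + int j \<le> fst z}"
  have Z12: "Z = Z1 \<union> Z2" and fin12: "finite Z1" "finite Z2"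
    using Z fin by (force simp: Z1_def Z2_def)+
  have "\<bar>pr (Z1 \<union> B) - pr Z1 * pr B\<bar> \<le> \<alpha> j * (pr Z1 * pr B)"
    using j fin12 fin B by (intro psi_mixing[of j _ _ "u - int j"]) (force simp: Z1_def)+
  moreover have "\<bar>pr ((Z1 \<union> B) \<union> Z2) - pr (Z1 \<union> B) * pr Z2\<bar> \<le> \<alpha> j * (pr (Z1 \<union> B) * pr Z2)"
  proof (rule psi_mixing[of j _ _ v])
    show "i \<le> v" if "(i, a) \<in> Z1 \<union> B" for i a using that B[of i a] uv by (auto simp: Z1_def)
  qed (use j fin12 fin in \<open>auto simp: Z2_def\<close>)
  moreover have "\<bar>pr (Z1 \<union> Z2) - pr Z1 * pr Z2\<bar> \<le> \<alpha> j * (pr Z1 * pr Z2)"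
  proof (rule psi_mixing[of j _ _ v])
    show "i \<le> v" if "(i, a) \<in> Z1" for i a using that uv by (auto simp: Z1_def)
  qed (use j fin12 in \<open>auto simp: Z2_def\<close>)
  moreover have "(Z1 \<union> B) \<union> Z2 = Z \<union> B" using Z12 by blast
  ultimately show ?thesis
    using two_sided_product_estimate[of "pr (Z1 \<union> B)" "pr Z1" "pr B" "\<alpha> j" "pr (Z \<union> B)" "pr Z2" "pr Z"]
      \<alpha>_nonneg[of j] j Z12 by simp
qed

text \<open>The blocks are split off one at a time. Those still present join \<open>Z\<close> as
  constraints for the next one, and each splitting costs
  \<open>7 * \<alpha> j * pr Z\<close>.\<close>

lemma pr_UN_separated:
  assumes j: "1 \<le> j" "\<alpha> j \<le> 1 / 2" and fin: "finite I" "finite Z" and uv: "u \<le> v"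
    and Z: "\<And>k i c. k \<in> I \<Longrightarrow> (i, c) \<in> Z \<Longrightarrow> i + int j \<le> u + s k \<or> v + s k + int j \<le> i"
    and sep: "\<And>k k'. k \<in> I \<Longrightarrow> k' \<in> I \<Longrightarrow> k \<noteq> k' \<Longrightarrow> v - u + int j \<le> \<bar>s k - s k'\<bar>"
  shows "\<bar>pr (Z \<union> (\<Union>k\<in>I. block (a k) (s k) u v)) - (\<Prod>k\<in>I. pr (block (a k) (s k) u v)) * pr Z\<bar>
    \<le> 7 * real (card I) * \<alpha> j * pr Z"
  using fin(1) Z sep
proof (induction I)
  case empty
  then show ?case by simp
next
  case (insert k I)
  let ?B = "\<lambda>k. block (a k) (s k) u v"
  define Y where "Y = Z \<union> (\<Union>k\<in>I. ?B k)"
  have finY: "finite Y" using fin insert.hyps by (auto simp: Y_def)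
  \<comment> \<open>Shifts differing by at least \<open>v - u + j\<close> leave a gap of at least
    \<open>j\<close> between the two translated intervals.\<close>
  have far: "i + int j \<le> u + s k \<or> v + s k + int j \<le> i" if mem: "(i, c) \<in> Y" for i c
  proof (cases "(i, c) \<in> Z")
    case True
    then show ?thesis using insert.prems(1)[of k i c] by simp
  next
    case False
    then obtain k' where k': "k' \<in> I" "u + s k' \<le> i" "i \<le> v + s k'"
      using mem by (auto simp: Y_def block_def)
    then have "v - u + int j \<le> \<bar>s k - s k'\<bar>"
      using insert.prems(2)[of k k'] insert.hyps by blast
    then show ?thesis using k' by linarith
  qed
  have "\<bar>pr (Y \<union> ?B k) - pr (?B k) * pr Y\<bar> \<le> 7 * \<alpha> j * (pr (?B k) * pr Y)"
  proof (rule pr_Un_separated[of j _ _ "u + s k" "v + s k"])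
    show "u + s k \<le> i \<and> i \<le> v + s k" if "(i, c) \<in> ?B k" for i c
      using that by (auto simp: block_def)
    show "i + int j \<le> u + s k \<or> v + s k + int j \<le> i" if "(i, c) \<in> Y" for i c
      by (rule far[OF that])
  qed (use j finY uv in auto)
  also have "\<dots> \<le> 7 * \<alpha> j * (1 * pr Z)"
  proof (rule mult_left_mono)
    have "pr Y \<le> pr Z" using fin by (intro pr_antimono) (auto simp: Y_def)
    then show "pr (?B k) * pr Y \<le> 1 * pr Z" by (intro mult_mono) auto
  qed (use \<alpha>_nonneg[of j] in simp)
  finally have 1: "\<bar>pr (Y \<union> ?B k) - pr (?B k) * pr Y\<bar> \<le> 7 * \<alpha> j * pr Z" by simp
  have IH: "\<bar>pr Y - (\<Prod>k\<in>I. pr (?B k)) * pr Z\<bar> \<le> 7 * real (card I) * \<alpha> j * pr Z"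
    unfolding Y_def by (rule insert.IH) (use insert.prems in blast)+
  have "\<bar>pr (?B k) * pr Y - pr (?B k) * ((\<Prod>k\<in>I. pr (?B k)) * pr Z)\<bar>
      = pr (?B k) * \<bar>pr Y - (\<Prod>k\<in>I. pr (?B k)) * pr Z\<bar>"
    unfolding right_diff_distrib[symmetric] abs_mult by simp
  also have "\<dots> \<le> 1 * \<bar>pr Y - (\<Prod>k\<in>I. pr (?B k)) * pr Z\<bar>"
    by (intro mult_right_mono) auto
  also have "\<dots> \<le> 7 * real (card I) * \<alpha> j * pr Z"
    using IH by simp
  finally have 2: "\<bar>pr (?B k) * pr Y - pr (?B k) * ((\<Prod>k\<in>I. pr (?B k)) * pr Z)\<bar>
      \<le> 7 * real (card I) * \<alpha> j * pr Z" .
  have "Z \<union> (\<Union>k\<in>insert k I. ?B k) = Y \<union> ?B k" by (auto simp: Y_def)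
  then have "\<bar>pr (Z \<union> (\<Union>k\<in>insert k I. ?B k)) - pr (?B k) * ((\<Prod>k\<in>I. pr (?B k)) * pr Z)\<bar>
      \<le> 7 * \<alpha> j * pr Z + 7 * real (card I) * \<alpha> j * pr Z"
    using abs_diff_le_add[OF 1 2] by simp
  also have "\<dots> = 7 * real (card (insert k I)) * \<alpha> j * pr Z"
    using insert.hyps by (simp add: algebra_simps)
  finally show ?case
    using insert.hyps by (simp add: mult.assoc)
qed

end

section \<open>From the dependence coefficients to mixing inequalities\<close>

context shift_process
begin

text \<open>Multiplies out the quotient in the supremum. Finiteness matters because
  \<open>enn2real\<close> sends infinity to 0; null events, which the supremum omits, make both
  sides vanish.\<close>

lemma phi_coeff_mixing:
  assumes fin: "phi_coeff P k < \<infinity>" "finite Z" "finite V"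
    and Z: "\<And>i a. (i, a) \<in> Z \<Longrightarrow> i \<le> x" and V: "\<And>i a. (i, a) \<in> V \<Longrightarrow> x + int k \<le> i"
  shows "\<bar>pr (Z \<union> V) - pr Z * pr V\<bar> \<le> enn2real (phi_coeff P k) * pr Z"
proof (cases "pr Z = 0")
  case True
  then have "pr (Z \<union> V) = 0"
    using pr_antimono[of Z "Z \<union> V"] fin measure_nonneg[of P "fixing (Z \<union> V)"] by simp
  then show ?thesis using True by simp
next
  case False
  then have pos: "0 < pr Z" by (simp add: less_le)
  have "ennreal \<bar>pr (Z \<union> V) / pr Z - pr V\<bar> \<le> phi_dep P (coord_algebra {..x}) (coord_algebra {x + int k..})"
    unfolding phi_dep_def
  proof (rule SUP_upper2)
    show "(fixing Z, fixing V) \<in> {(A, B). A \<in> coord_algebra {..x} \<and> B \<in> coord_algebra {x + int k..} \<and> measure P A \<noteq> 0}"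
      using False Z V fin by (auto intro!: fixing_in_coord_algebra)
  qed (simp add: fixing_Un)
  also have "\<dots> \<le> phi_coeff P k"
    unfolding phi_coeff_def by (rule SUP_upper) simp
  also have "\<dots> = ennreal (enn2real (phi_coeff P k))"
    using fin by (simp add: ennreal_enn2real)
  finally have "\<bar>pr (Z \<union> V) / pr Z - pr V\<bar> \<le> enn2real (phi_coeff P k)"
    by (simp add: ennreal_le_iff)
  then have "\<bar>pr (Z \<union> V) / pr Z - pr V\<bar> * pr Z \<le> enn2real (phi_coeff P k) * pr Z"
    by (rule mult_right_mono) simp
  moreover have "\<bar>pr (Z \<union> V) / pr Z - pr V\<bar> * pr Z = \<bar>(pr (Z \<union> V) / pr Z - pr V) * pr Z\<bar>"
    by (simp add: abs_mult)
  moreover have "(pr (Z \<union> V) / pr Z - pr V) * pr Z = pr (Z \<union> V) - pr Z * pr V"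
    using pos by (simp add: field_simps)
  ultimately show ?thesis by simp
qed

lemma psi_coeff_mixing:
  assumes fin: "psi_coeff P k < \<infinity>" "finite Z" "finite V"
    and Z: "\<And>i a. (i, a) \<in> Z \<Longrightarrow> i \<le> x" and V: "\<And>i a. (i, a) \<in> V \<Longrightarrow> x + int k \<le> i"
  shows "\<bar>pr (Z \<union> V) - pr Z * pr V\<bar> \<le> enn2real (psi_coeff P k) * (pr Z * pr V)"
proof (cases "pr Z * pr V = 0")
  case True
  then have "pr (Z \<union> V) = 0"
    using pr_antimono[of Z "Z \<union> V"] pr_antimono[of V "Z \<union> V"] fin measure_nonneg[of P "fixing (Z \<union> V)"]
    by (simp, linarith)
  then show ?thesis unfolding True by simp
next
  case False
  let ?c = "pr Z * pr V"
  have pos: "0 < ?c" using False by (simp add: less_le)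
  have "ennreal \<bar>pr (Z \<union> V) / ?c - 1\<bar> \<le> psi_dep P (coord_algebra {..x}) (coord_algebra {x + int k..})"
    unfolding psi_dep_def
  proof (rule SUP_upper2)
    show "(fixing Z, fixing V) \<in> {(A, B). A \<in> coord_algebra {..x} \<and> B \<in> coord_algebra {x + int k..}
        \<and> measure P A * measure P B \<noteq> 0}"
      using False Z V fin by (auto intro!: fixing_in_coord_algebra)
  qed (simp add: fixing_Un)
  also have "\<dots> \<le> psi_coeff P k"
    unfolding psi_coeff_def by (rule SUP_upper) simp
  also have "\<dots> = ennreal (enn2real (psi_coeff P k))"
    using fin by (simp add: ennreal_enn2real)
  finally have "\<bar>pr (Z \<union> V) / ?c - 1\<bar> \<le> enn2real (psi_coeff P k)"
    by (simp add: ennreal_le_iff)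
  then have "\<bar>pr (Z \<union> V) / ?c - 1\<bar> * ?c \<le> enn2real (psi_coeff P k) * ?c"
    by (rule mult_right_mono) simp
  moreover have "\<bar>pr (Z \<union> V) / ?c - 1\<bar> * ?c = \<bar>(pr (Z \<union> V) / ?c - 1) * ?c\<bar>"
    unfolding abs_mult using pos by simp
  moreover have "(pr (Z \<union> V) / ?c - 1) * ?c = pr (Z \<union> V) - ?c"
  proof -
    have "(x / c - 1) * c = x - c" if "0 < c" for x c :: real
      using that by (simp add: field_simps)
    from this[OF pos] show ?thesis .
  qed
  ultimately show ?thesis by simp
qed

end

text \<open>The coefficient at index 0 may be infinite. Its real value is then 0, and a single term
  does not affect summability.\<close>

lemma summable_enn2real_Suc:
  fixes f :: "nat \<Rightarrow> ennreal"
  assumes "(\<Sum>n. f (Suc n)) < \<infinity>"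
  shows "summable (\<lambda>n. enn2real (f n))" and "1 \<le> k \<Longrightarrow> f k < \<infinity>"
proof -
  have fin: "f (Suc n) < \<infinity>" for n
    using sum_le_suminf[of "\<lambda>n. f (Suc n)" "{n}"] assms by (auto intro: le_less_trans)
  have "summable (\<lambda>n. enn2real (f (Suc n)))"
  proof (rule summable_suminf_not_top)
    show "(\<Sum>n. ennreal (enn2real (f (Suc n)))) \<noteq> \<top>"
      using assms fin by (simp add: less_top)
  qed simp
  then show "summable (\<lambda>n. enn2real (f n))"
    by (subst (asm) summable_Suc_iff)
  show "1 \<le> k \<Longrightarrow> f k < \<infinity>"
    using fin[of "k - 1"] by simp
qed

section \<open>Second moments of hitting sums\<close>

lemma prod_le_factor:
  fixes x :: "'b \<Rightarrow> real"
  assumes "finite I" "k \<in> I" "\<And>i. i \<in> I \<Longrightarrow> 0 \<le> x i" "\<And>i. i \<in> I \<Longrightarrow> x i \<le> 1"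
  shows "(\<Prod>i\<in>I. x i) \<le> x k"
proof -
  have "(\<Prod>i\<in>I. x i) = x k * (\<Prod>i\<in>I - {k}. x i)"
    using assms by (simp add: prod.remove)
  also have "\<dots> \<le> x k * 1"
    using assms by (intro mult_left_mono prod_le_1) auto
  finally show ?thesis by simp
qed

text \<open>Reduces many distances to one. The minimum is attained, so the error at the minimum is
  one of the summands, without any monotonicity of \<open>f\<close>.\<close>

lemma obtain_minimal_value:
  fixes f :: "nat \<Rightarrow> real"
  assumes S: "finite S" "S \<noteq> {}" and f: "\<And>k. 0 \<le> f k"
  obtains \<kappa> where "\<And>x. x \<in> S \<Longrightarrow> \<kappa> \<le> v x" "f \<kappa> \<le> (\<Sum>x\<in>S. f (v x))"
proof -
  have "Min (v ` S) \<in> v ` S"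
    using S by (intro Min_in) auto
  then obtain y where y: "y \<in> S" "Min (v ` S) = v y"
    by auto
  show ?thesis
  proof
    show "v y \<le> v x" if "x \<in> S" for x
      using S that unfolding y(2)[symmetric] by simp
    show "f (v y) \<le> (\<Sum>x\<in>S. f (v x))"
      using S y f by (intro member_le_sum) auto
  qed
qed

text \<open>Encodes the event that the \<open>n\<close>-th summand of the hitting sum equals
  1.\<close>

definition hit_constraints ::
  "nat \<Rightarrow> (nat \<Rightarrow> nat \<Rightarrow> nat) \<Rightarrow> (nat \<Rightarrow> nat \<Rightarrow> int \<Rightarrow> 'a) \<Rightarrow> (nat \<Rightarrow> int) \<Rightarrow> (nat \<Rightarrow> int) \<Rightarrow> nat \<Rightarrow> (int \<times> 'a) set"
  where "hit_constraints l q a lo hi n = (\<Union>i\<in>{1..l}. block (a i n) (int (q i n)) (lo n) (hi n))"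

lemma finite_hit_constraints [simp]: "finite (hit_constraints l q a lo hi n)"
  by (simp add: hit_constraints_def)

text \<open>The hypotheses \<open>short_single\<close> and \<open>short_pair\<close> concern cylinders shorter than the gaps
  between their translates, which is the only situation where \<open>\<phi>\<close>-mixing and \<open>\<psi>\<close>-mixing have to be
  used differently.\<close>

locale hit_process = phi_mixing_shift P \<alpha> for P :: "(int \<Rightarrow> 'a::countable) measure" and \<alpha> +
  fixes l :: nat and q :: "nat \<Rightarrow> nat \<Rightarrow> nat" and a :: "nat \<Rightarrow> nat \<Rightarrow> int \<Rightarrow> 'a"
    and lo hi :: "nat \<Rightarrow> int" and M D j0 :: nat and h :: "nat \<Rightarrow> real"
  assumes l_ge_1: "1 \<le> l"
    and fibre: "\<And>i k F. i \<in> {1..l} \<Longrightarrow> finite F \<Longrightarrow> card {n \<in> F. q i n = k} \<le> M"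
    and fibre_diff: "\<And>i i' k F. i \<in> {1..l} \<Longrightarrow> i' \<in> {1..l} \<Longrightarrow> i \<noteq> i' \<Longrightarrow> finite F \<Longrightarrow>
      card {n \<in> F. int (q i n) - int (q i' n) = k} \<le> M"
    and fibre_max: "\<And>m F. finite F \<Longrightarrow>
      card {n \<in> F. m < n \<and> Max ((\<lambda>i. q i n) ` {1..l}) \<le> Max ((\<lambda>i. q i m) ` {1..l})} \<le> M"
    and lo_le_hi: "\<And>n. 1 \<le> n \<Longrightarrow> lo n \<le> hi n"
    and hi_nested: "\<And>m n. 1 \<le> m \<Longrightarrow> m < n \<Longrightarrow> hi m \<le> hi n + int D"
    and h_nonneg: "\<And>j. 0 \<le> h j" and h_summable: "summable h"
    and short_single: "\<And>j n. j0 \<le> j \<Longrightarrow> 1 \<le> j \<Longrightarrow> 1 \<le> n \<Longrightarrow> hi n - lo n + 1 < int j \<Longrightarrow>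
      (\<And>i i'. i \<in> {1..l} \<Longrightarrow> i' \<in> {1..l} \<Longrightarrow> i \<noteq> i' \<Longrightarrow> 2 * int j + int D \<le> \<bar>int (q i n) - int (q i' n)\<bar>) \<Longrightarrow>
      \<bar>pr (hit_constraints l q a lo hi n) - (\<Prod>i = 1..l. pr (block (a i n) 0 (lo n) (hi n)))\<bar> \<le> h j"
    and short_pair: "\<And>j m n. j0 \<le> j \<Longrightarrow> 1 \<le> j \<Longrightarrow> 1 \<le> m \<Longrightarrow> m < n \<Longrightarrow> hi n - lo n + 1 < int j \<Longrightarrow>
      Max ((\<lambda>i. q i m) ` {1..l}) < Max ((\<lambda>i. q i n) ` {1..l}) \<Longrightarrow>
      (\<And>i i'. i \<in> {1..l} \<Longrightarrow> i' \<in> {1..l} \<Longrightarrow> i \<noteq> i' \<Longrightarrow> 2 * int j + int D \<le> \<bar>int (q i n) - int (q i' n)\<bar>) \<Longrightarrow>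
      (\<And>i i'. i \<in> {1..l} \<Longrightarrow> i' \<in> {1..l} \<Longrightarrow> 2 * int j + int D \<le> \<bar>int (q i m) - int (q i' n)\<bar>) \<Longrightarrow>
      \<bar>pr (hit_constraints l q a lo hi m \<union> hit_constraints l q a lo hi n)
        - (\<Prod>i = 1..l. pr (block (a i n) 0 (lo n) (hi n))) * pr (hit_constraints l q a lo hi m)\<bar>
      \<le> h j * pr (hit_constraints l q a lo hi m)"
begin

abbreviation W :: "nat \<Rightarrow> (int \<times> 'a) set" where
  "W n \<equiv> hit_constraints l q a lo hi n"

definition p :: "nat \<Rightarrow> real" where
  "p n = (\<Prod>i = 1..l. pr (block (a i n) 0 (lo n) (hi n)))"

definition Q :: "nat \<Rightarrow> nat" where
  "Q n = Max ((\<lambda>i. q i n) ` {1..l})"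

lemma p_nonneg: "0 \<le> p n" and p_le_1: "p n \<le> 1"
  unfolding p_def by (auto intro: prod_nonneg prod_le_1)

lemma q_le_Q: "i \<in> {1..l} \<Longrightarrow> q i n \<le> Q n"
  unfolding Q_def by (intro Max_ge) auto

lemma Q_attained:
  obtains i where "i \<in> {1..l}" "q i n = Q n"
proof -
  have "Q n \<in> (\<lambda>i. q i n) ` {1..l}"
    unfolding Q_def using l_ge_1 by (intro Max_in) auto
  then show ?thesis using that by auto
qed

lemma W_position_le: "(i, c) \<in> W n \<Longrightarrow> i \<le> hi n + int (Q n)"
  unfolding hit_constraints_def block_def using q_le_Q[of _ n] by fastforce

lemma p_le_decay:
  assumes "int j \<le> hi n - lo n + 1" "\<And>a s u v. int j \<le> v - u + 1 \<Longrightarrow> pr (block a s u v) \<le> \<epsilon>"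
  shows "p n \<le> \<epsilon>"
proof -
  have "p n \<le> pr (block (a 1 n) 0 (lo n) (hi n))"
    unfolding p_def using l_ge_1 by (intro prod_le_factor) auto
  also have "\<dots> \<le> \<epsilon>" using assms by blast
  finally show ?thesis .
qed

lemma abs_diff_le_of_pr_le:
  assumes "pr (Z \<union> W n) \<le> x * pr Z" "p n \<le> y" "0 \<le> x" "0 \<le> y"
  shows "\<bar>pr (Z \<union> W n) - p n * pr Z\<bar> \<le> (x + y) * pr Z"
proof -
  have "p n * pr Z \<le> y * pr Z" using assms by (intro mult_right_mono) auto
  moreover have "0 \<le> p n * pr Z" "0 \<le> x * pr Z" using p_nonneg assms by auto
  moreover have "(x + y) * pr Z = x * pr Z + y * pr Z" by (simp add: distrib_right)
  ultimately show ?thesis using assms(1) measure_nonneg[of P "fixing (Z \<union> W n)"] by linarith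
qed

lemma trivial_estimate: "finite Z \<Longrightarrow> \<bar>pr (Z \<union> W n) - p n * pr Z\<bar> \<le> 1 * pr Z"
proof -
  assume "finite Z"
  then have "pr (Z \<union> W n) \<le> pr Z" by (intro pr_antimono) auto
  moreover have "p n * pr Z \<le> 1 * pr Z" using p_le_1 by (intro mult_right_mono) auto
  moreover have "0 \<le> p n * pr Z" using p_nonneg by auto
  ultimately show ?thesis using measure_nonneg[of P "fixing (Z \<union> W n)"] by linarith
qed

text \<open>Both terms are small, so no cancellation is sought. The tail of the rightmost translate
  bounds the joint probability by \<open>(\<alpha> j + \<epsilon>) * pr Z\<close>, and a single
  factor bounds \<open>p n\<close> by \<open>\<epsilon>\<close>.\<close>

lemma long_estimate:
  assumes j: "1 \<le> j" and n: "int j \<le> hi n - lo n + 1" and fin: "finite Z"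
    and Z: "\<And>i c. (i, c) \<in> Z \<Longrightarrow> i + 2 * int j \<le> hi n + int (Q n)"
    and decay: "\<And>a s u v. int j \<le> v - u + 1 \<Longrightarrow> pr (block a s u v) \<le> \<epsilon>"
  shows "\<bar>pr (Z \<union> W n) - p n * pr Z\<bar> \<le> (\<alpha> j + 2 * \<epsilon>) * pr Z"
proof -
  obtain i where i: "i \<in> {1..l}" "q i n = Q n" by (rule Q_attained)
  have \<epsilon>: "0 \<le> \<epsilon>" using decay[OF n] measure_nonneg order_trans by blast
  have "pr (Z \<union> W n) \<le> (\<alpha> j + \<epsilon>) * pr Z"
  proof (rule pr_Un_tail_le[OF j fin])
    show "block (a i n) (int (q i n)) (lo n) (hi n) \<subseteq> W n"
      using i unfolding hit_constraints_def by blast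
    show "k + 2 * int j \<le> hi n + int (q i n)" if "(k, c) \<in> Z" for k c
      using Z[OF that] i by simp
  qed (use n decay in auto)
  moreover have "p n \<le> \<epsilon>" by (rule p_le_decay[OF n decay])
  ultimately have "\<bar>pr (Z \<union> W n) - p n * pr Z\<bar> \<le> ((\<alpha> j + \<epsilon>) + \<epsilon>) * pr Z"
    using \<alpha>_nonneg[of j] \<epsilon> by (intro abs_diff_le_of_pr_le) auto
  then show ?thesis by (simp add: algebra_simps)
qed

text \<open>Below, \<open>\<kappa>\<close> is the least distance between the translates involved. It leaves room for gaps of
  length \<open>j = (\<kappa> - D) div 2\<close>, truncated at \<open>0\<close>, where the trivial bound \<open>1\<close> is used.\<close>

lemma AE_hit_process_ratio_one:
  assumes top: "filterlim (\<lambda>N. \<Sum>n = 1..N. p n) at_top sequentially"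
  shows "AE \<omega> in P. (\<lambda>N. (\<Sum>n = 1..N. indicator (fixing (W n)) \<omega>) / (\<Sum>n = 1..N. p n)) \<longlonglongrightarrow> 1"
proof -
  obtain \<epsilon> where \<epsilon>: "summable \<epsilon>" "\<And>t. 0 \<le> \<epsilon> t"
    and decay: "\<And>a s u v t. int t \<le> v - u + 1 \<Longrightarrow> pr (block a s u v) \<le> \<epsilon> t"
    using block_decay by blast
  \<comment> \<open>One error for all cases: \<open>h\<close> covers short cylinders,
    \<open>\<alpha> + 2 * \<epsilon>\<close> long ones.\<close>
  define g where "g j = (if j < max 1 j0 then 1 else h j + (\<alpha> j + 2 * \<epsilon> j))" for j
  define f where "f k = g ((k - D) div 2)" for k
  have g_nonneg: "0 \<le> g j" for j
    using h_nonneg \<alpha>_nonneg \<epsilon>(2) by (simp add: g_def)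
  have "summable g"
  proof (rule summable_comparison_test')
    show "summable (\<lambda>j. h j + (\<alpha> j + 2 * \<epsilon> j))"
      by (intro summable_add summable_mult h_summable \<alpha>_summable \<epsilon>)
    show "norm (g n) \<le> h n + (\<alpha> n + 2 * \<epsilon> n)" if "max 1 j0 \<le> n" for n
    proof -
      have "g n = h n + (\<alpha> n + 2 * \<epsilon> n)" using that by (auto simp: g_def less_max_iff_disj)
      then show ?thesis using g_nonneg[of n] by simp
    qed
  qed
  then have f_sum: "summable f"
    unfolding f_def
  proof (rule summable_comp_fibre[OF _ g_nonneg])
    \<comment> \<open>Truncated subtraction gives the value 0 for all \<open>n \<le> D + 1\<close>,
      whence windows of length \<open>D + 2\<close>.\<close>
    show "{n. (n - D) div 2 = k} \<subseteq> {2 * k..<2 * k + (D + 2)}" for k by auto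
  qed
  have f_nonneg: "0 \<le> f k" for k by (simp add: f_def g_nonneg)
  \<comment> \<open>Used with \<open>I1\<close> for the distances between the translates of indices
    \<open>m\<close> and \<open>n\<close>, and on the diagonal \<open>m = n\<close> with
    \<open>I2\<close> for those within one index.\<close>
  define d1 where "d1 m n = (\<lambda>(i, i'). nat \<bar>int (q i m) - int (q i' n)\<bar>)" for m n
  define I1 where "I1 = {1..l} \<times> {1..l}"
  define I2 where "I2 = {(i, i') \<in> I1. i \<noteq> i'}"
  have fin_I: "finite I1" "finite I2" by (auto simp: I1_def I2_def intro: finite_subset[of _ "{1..l} \<times> {1..l}"])
  define b where "b n = (\<Sum>x\<in>I2. f (d1 n n x))" for n
  \<comment> \<open>The last term pays for the boundedly many \<open>n\<close> violating
    \<open>Q m < Q n\<close>, where only the trivial estimate is used.\<close>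
  define c where "c m n = (\<Sum>x\<in>I1. f (d1 m n x)) + b n + (if Q n \<le> Q m then 1 else 0)" for m n
  define B where "B = real (card I1) * (real (2 * M) * suminf f)"
  have S: "0 \<le> suminf f" using f_sum f_nonneg by (intro suminf_nonneg)
  have b_nonneg: "0 \<le> b n" for n unfolding b_def using f_nonneg by (intro sum_nonneg)
  have c1_sum: "(\<Sum>n\<in>F. \<Sum>x\<in>I1. f (d1 m n x)) \<le> B" if F: "finite F" for F m
  proof -
    have "(\<Sum>n\<in>F. f (d1 m n x)) \<le> real (2 * M) * suminf f" if x: "x \<in> I1" for x
    proof (rule sum_comp_le[OF f_sum f_nonneg F])
      obtain i i' where ii: "x = (i, i')" "i' \<in> {1..l}" using x by (auto simp: I1_def)
      show "card {n \<in> F. d1 m n x = k} \<le> 2 * M" for k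
      proof -
        \<comment> \<open>A prescribed distance leaves two candidates for \<open>q i' n\<close>, one
          on each side of \<open>q i m\<close>.\<close>
        have "{n \<in> F. d1 m n x = k} \<subseteq> {n \<in> F. q i' n = nat (int (q i m) - int k)} \<union> {n \<in> F. q i' n = nat (int (q i m) + int k)}"
          by (auto simp: d1_def ii)
        then have "card {n \<in> F. d1 m n x = k} \<le> card ({n \<in> F. q i' n = nat (int (q i m) - int k)} \<union> {n \<in> F. q i' n = nat (int (q i m) + int k)})"
          using F by (intro card_mono) auto
        also have "\<dots> \<le> M + M"
          by (rule order_trans[OF card_Un_le add_mono[OF fibre[OF ii(2) F] fibre[OF ii(2) F]]])
        finally show ?thesis by simp
      qed
    qed
    then show ?thesis
      unfolding B_def by (subst sum.swap) (rule sum_bounded_above)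
  qed
  have b_sum: "(\<Sum>n\<in>F. b n) \<le> B" if F: "finite F" for F
  proof -
    have "(\<Sum>n\<in>F. f (d1 n n x)) \<le> real (2 * M) * suminf f" if x: "x \<in> I2" for x
    proof (rule sum_comp_le[OF f_sum f_nonneg F])
      obtain i i' where ii: "x = (i, i')" "i \<in> {1..l}" "i' \<in> {1..l}" "i \<noteq> i'" using x by (auto simp: I1_def I2_def)
      show "card {n \<in> F. d1 n n x = k} \<le> 2 * M" for k
      proof -
        have "{n \<in> F. d1 n n x = k} \<subseteq> {n \<in> F. int (q i n) - int (q i' n) = int k} \<union> {n \<in> F. int (q i n) - int (q i' n) = - int k}"
          by (auto simp: d1_def ii)
        then have "card {n \<in> F. d1 n n x = k} \<le> card ({n \<in> F. int (q i n) - int (q i' n) = int k} \<union> {n \<in> F. int (q i n) - int (q i' n) = - int k})"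
          using F by (intro card_mono) auto
        also have "\<dots> \<le> M + M"
          by (rule order_trans[OF card_Un_le add_mono[OF fibre_diff[OF ii(2-4) F] fibre_diff[OF ii(2-4) F]]])
        finally show ?thesis by simp
      qed
    qed
    then have "(\<Sum>n\<in>F. b n) \<le> real (card I2) * (real (2 * M) * suminf f)"
      unfolding b_def by (subst sum.swap) (rule sum_bounded_above)
    also have "\<dots> \<le> B"
      unfolding B_def using S fin_I by (intro mult_right_mono) (auto simp: I2_def intro!: card_mono)
    finally show ?thesis .
  qed
  have B_nonneg: "0 \<le> B" using b_sum[of "{}"] by simp
  have c_sum: "(\<Sum>n\<in>{m<..N}. c m n) \<le> B + B + real M" for m N
  proof -
    have "(\<Sum>n\<in>{m<..N}. if Q n \<le> Q m then 1 else 0 :: real) = real (card {n \<in> {m<..N}. Q n \<le> Q m})"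
      by (subst sum.inter_filter[symmetric]) auto
    also have "\<dots> = real (card {n \<in> {m<..N}. m < n \<and> Q n \<le> Q m})"
      by (intro arg_cong[of _ _ "\<lambda>S. real (card S)"]) auto
    also have "\<dots> \<le> real M"
      using fibre_max[of "{m<..N}" m] by (simp add: Q_def)
    finally show ?thesis
      unfolding c_def sum.distrib using c1_sum[of "{m<..N}" m] b_sum[of "{m<..N}"] by simp
  qed
  have pair: "\<bar>pr (W m \<union> W n) - p n * pr (W m)\<bar> \<le> c m n * pr (W m)" if m: "1 \<le> m" "m < n" for m n
  proof (cases "Q n \<le> Q m")
    case True
    have "1 \<le> c m n" using True b_nonneg[of n] sum_nonneg[of I1 "\<lambda>x. f (d1 m n x)"] f_nonneg by (simp add: c_def)
    then have "1 * pr (W m) \<le> c m n * pr (W m)" by (intro mult_right_mono) auto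
    then show ?thesis using trivial_estimate[of "W m" n] by simp
  next
    case False
    obtain \<kappa> where \<kappa>: "\<And>x. x \<in> I1 <+> I2 \<Longrightarrow> \<kappa> \<le> case_sum (d1 m n) (d1 n n) x"
      and f\<kappa>: "f \<kappa> \<le> (\<Sum>x\<in>I1 <+> I2. f (case_sum (d1 m n) (d1 n n) x))"
    proof (rule obtain_minimal_value[where f = f and S = "I1 <+> I2" and v = "case_sum (d1 m n) (d1 n n)"])
      show "finite (I1 <+> I2)" using fin_I by simp
      show "I1 <+> I2 \<noteq> {}" using l_ge_1 by (auto simp: I1_def)
    qed (use f_nonneg in auto)
    have \<kappa>1: "int \<kappa> \<le> \<bar>int (q i m) - int (q i' n)\<bar>" if "i \<in> {1..l}" "i' \<in> {1..l}" for i i'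
    proof -
      have "(i, i') \<in> I1" using that by (simp add: I1_def)
      from \<kappa>[OF InlI[OF this]] show ?thesis by (simp add: d1_def le_nat_iff)
    qed
    have \<kappa>2: "int \<kappa> \<le> \<bar>int (q i n) - int (q i' n)\<bar>" if "i \<in> {1..l}" "i' \<in> {1..l}" "i \<noteq> i'" for i i'
    proof -
      have "(i, i') \<in> I2" using that by (simp add: I1_def I2_def)
      from \<kappa>[OF InrI[OF this]] show ?thesis by (simp add: d1_def le_nat_iff)
    qed
    define j where "j = (\<kappa> - D) div 2"
    have "\<bar>pr (W m \<union> W n) - p n * pr (W m)\<bar> \<le> g j * pr (W m)"
    proof (cases "j < max 1 j0")
      case True
      then show ?thesis using trivial_estimate[of "W m" n] by (simp add: g_def)
    next
      case big: False
      then have j: "1 \<le> j" "j0 \<le> j" by auto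
      then have sep: "2 * int j + int D \<le> int \<kappa>" unfolding j_def by linarith
      have "\<bar>pr (W m \<union> W n) - p n * pr (W m)\<bar> \<le> (h j + (\<alpha> j + 2 * \<epsilon> j)) * pr (W m)"
      proof (cases "int j \<le> hi n - lo n + 1")
        case True
        obtain i i' where i: "i \<in> {1..l}" "q i m = Q m" "i' \<in> {1..l}" "q i' n = Q n"
          using Q_attained by metis
        \<comment> \<open>The separation applied to the two maximal values; \<open>Q m < Q n\<close>
          decides the sign of the difference.\<close>
        then have gap: "int (Q m) + 2 * int j + int D \<le> int (Q n)"
          using \<kappa>1[of i i'] sep False by simp
        have "\<bar>pr (W m \<union> W n) - p n * pr (W m)\<bar> \<le> (\<alpha> j + 2 * \<epsilon> j) * pr (W m)"
        proof (rule long_estimate[OF j(1) True])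
          \<comment> \<open>The \<open>D\<close> in \<open>gap\<close> absorbs the amount by which
            \<open>hi m\<close> may exceed \<open>hi n\<close>.\<close>
          show "k + 2 * int j \<le> hi n + int (Q n)" if "(k, c) \<in> W m" for k c
            using W_position_le[OF that] hi_nested[OF m] gap by linarith
        qed (use decay in auto)
        also have "\<dots> \<le> (h j + (\<alpha> j + 2 * \<epsilon> j)) * pr (W m)"
          using h_nonneg by (intro mult_right_mono) auto
        finally show ?thesis .
      next
        case short: False
        have "\<bar>pr (W m \<union> W n) - p n * pr (W m)\<bar> \<le> h j * pr (W m)"
          unfolding p_def
        proof (rule short_pair[OF j(2,1) m])
          show "2 * int j + int D \<le> \<bar>int (q i n) - int (q i' n)\<bar>" if "i \<in> {1..l}" "i' \<in> {1..l}" "i \<noteq> i'" for i i'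
            using \<kappa>2[OF that] sep by linarith
          show "2 * int j + int D \<le> \<bar>int (q i m) - int (q i' n)\<bar>" if "i \<in> {1..l}" "i' \<in> {1..l}" for i i'
            using \<kappa>1[OF that] sep by linarith
        qed (use short False in \<open>auto simp: Q_def\<close>)
        also have "\<dots> \<le> (h j + (\<alpha> j + 2 * \<epsilon> j)) * pr (W m)"
          using \<alpha>_nonneg \<epsilon>(2) by (intro mult_right_mono) auto
        finally show ?thesis .
      qed
      then show ?thesis using big by (simp add: g_def)
    qed
    also have "g j = f \<kappa>" by (simp add: f_def j_def)
    also have "f \<kappa> * pr (W m) \<le> c m n * pr (W m)"
      using f\<kappa> fin_I by (intro mult_right_mono) (simp_all add: c_def b_def sum.Plus)
    finally show ?thesis .
  qed
  \<comment> \<open>For \<open>l = 1\<close> stationarity gives equality. Otherwise the reasoning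
    for pairs is repeated with no constraints from an earlier index, so only the distances in
    \<open>I2\<close> enter.\<close>
  have single: "\<bar>pr (W n) - p n\<bar> \<le> b n" if n: "1 \<le> n" for n
  proof (cases "l = 1")
    case True
    have "pr (W n) = p n"
      unfolding p_def hit_constraints_def using pr_block_shift[of _ 0 "q 1 n"] by (simp add: True)
    then show ?thesis using b_nonneg by simp
  next
    case False
    obtain \<kappa> where \<kappa>: "\<And>x. x \<in> I2 \<Longrightarrow> \<kappa> \<le> d1 n n x" and f\<kappa>: "f \<kappa> \<le> (\<Sum>x\<in>I2. f (d1 n n x))"
    proof (rule obtain_minimal_value[where f = f and S = I2 and v = "d1 n n"])
      show "finite I2" by (rule fin_I)
      have "(1, 2) \<in> I2" using l_ge_1 False by (auto simp: I1_def I2_def)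
      then show "I2 \<noteq> {}" by blast
    qed (use f_nonneg in auto)
    have \<kappa>2: "int \<kappa> \<le> \<bar>int (q i n) - int (q i' n)\<bar>" if "i \<in> {1..l}" "i' \<in> {1..l}" "i \<noteq> i'" for i i'
    proof -
      have "(i, i') \<in> I2" using that by (simp add: I1_def I2_def)
      from \<kappa>[OF this] show ?thesis by (simp add: d1_def le_nat_iff)
    qed
    define j where "j = (\<kappa> - D) div 2"
    have "\<bar>pr (W n) - p n\<bar> \<le> g j"
    proof (cases "j < max 1 j0")
      case True
      then show ?thesis using trivial_estimate[of "{}" n] by (simp add: g_def)
    next
      case big: False
      then have j: "1 \<le> j" "j0 \<le> j" by auto
      then have sep: "2 * int j + int D \<le> int \<kappa>" unfolding j_def by linarith
      have "\<bar>pr (W n) - p n\<bar> \<le> h j + (\<alpha> j + 2 * \<epsilon> j)"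
      proof (cases "int j \<le> hi n - lo n + 1")
        case True
        have "\<bar>pr ({} \<union> W n) - p n * pr {}\<bar> \<le> (\<alpha> j + 2 * \<epsilon> j) * pr {}"
          by (rule long_estimate[OF j(1) True]) (use decay in auto)
        then show ?thesis using h_nonneg[of j] by simp
      next
        case short: False
        have "\<bar>pr (W n) - p n\<bar> \<le> h j"
          unfolding p_def
        proof (rule short_single[OF j(2,1) n])
          show "2 * int j + int D \<le> \<bar>int (q i n) - int (q i' n)\<bar>" if "i \<in> {1..l}" "i' \<in> {1..l}" "i \<noteq> i'" for i i'
            using \<kappa>2[OF that] sep by linarith
        qed (use short in auto)
        then show ?thesis using \<alpha>_nonneg[of j] \<epsilon>(2)[of j] by linarith
      qed
      then show ?thesis using big by (simp add: g_def)
    qed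
    also have "g j = f \<kappa>" by (simp add: f_def j_def)
    also have "\<dots> \<le> b n" using f\<kappa> by (simp add: b_def)
    finally show ?thesis .
  qed
  show ?thesis
  proof (rule AE_hits_ratio_one[where b = b and a = c and B = "B + B + real M"])
    show "measure P (fixing (W m) \<inter> fixing (W n)) - p n * pr (W m) \<le> c m n * pr (W m)"
      if "1 \<le> m" "m < n" for m n
      using pair[OF that] by (simp add: fixing_Un abs_le_iff)
    show "(\<Sum>n = 1..N. b n) \<le> B + B + real M" for N
      using b_sum[of "{1..N}"] B_nonneg by simp
  qed (use p_nonneg p_le_1 single c_sum top in auto)
qed

end

section \<open>Short cylinders in the two mixing regimes\<close>

text \<open>With a single translate and \<open>q 1 m < q 1 n\<close>, the short cylinder of
  \<open>n\<close> lies wholly to the right of that of \<open>m\<close> with a gap of at least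
  \<open>j\<close>. One-sided mixing and right nesting therefore suffice, with error
  \<open>\<alpha> j\<close>.\<close>

lemma (in phi_mixing_shift) phi_single_ratio_one:
  fixes q :: "nat \<Rightarrow> nat \<Rightarrow> nat" and a :: "nat \<Rightarrow> nat \<Rightarrow> int \<Rightarrow> 'a" and lo hi :: "nat \<Rightarrow> int" and M D :: nat
  assumes fibre: "\<And>k F. finite F \<Longrightarrow> card {n \<in> F. q 1 n = k} \<le> M"
    and fibre_max: "\<And>m F. finite F \<Longrightarrow> card {n \<in> F. m < n \<and> q 1 n \<le> q 1 m} \<le> M"
    and lo_le_hi: "\<And>n. 1 \<le> n \<Longrightarrow> lo n \<le> hi n"
    and hi_nested: "\<And>m n. 1 \<le> m \<Longrightarrow> m < n \<Longrightarrow> hi m \<le> hi n + int D"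
    and top: "filterlim (\<lambda>N. \<Sum>n = 1..N. \<Prod>i = 1..1. pr (block (a i n) 0 (lo n) (hi n))) at_top sequentially"
  shows "AE \<omega> in P. (\<lambda>N. (\<Sum>n = 1..N. indicator (fixing (hit_constraints 1 q a lo hi n)) \<omega>)
    / (\<Sum>n = 1..N. \<Prod>i = 1..1. pr (block (a i n) 0 (lo n) (hi n)))) \<longlonglongrightarrow> 1"
proof -
  have shift: "pr (block b (int k) u v) = pr (block b 0 u v)" for b k u v
    using pr_block_shift[of b 0 k u v] by simp
  interpret hit_process P \<alpha> 1 q a lo hi M D 1 \<alpha>
  proof
    fix j m n :: nat
    assume j: "1 \<le> j" and m: "1 \<le> m" "m < n" and short: "hi n - lo n + 1 < int j"
      and max: "Max ((\<lambda>i. q i m) ` {1..1}) < Max ((\<lambda>i. q i n) ` {1..1})"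
      and sep: "\<And>i i'. i \<in> {1..1} \<Longrightarrow> i' \<in> {1..1} \<Longrightarrow> 2 * int j + int D \<le> \<bar>int (q i m) - int (q i' n)\<bar>"
    let ?Z = "hit_constraints 1 q a lo hi m" and ?B = "block (a 1 n) (int (q 1 n)) (lo n) (hi n)"
    have gap: "int (q 1 m) + 2 * int j + int D \<le> int (q 1 n)"
      using sep[of 1 1] max by simp
    have "\<bar>pr (?Z \<union> ?B) - pr ?Z * pr ?B\<bar> \<le> \<alpha> j * pr ?Z"
    proof (rule phi_mixing[of j _ _ "hi m + int (q 1 m)"])
      show "i \<le> hi m + int (q 1 m)" if "(i, c) \<in> ?Z" for i c
        using that by (auto simp: hit_constraints_def block_def)
      show "hi m + int (q 1 m) + int j \<le> i" if "(i, c) \<in> ?B" for i c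
      proof -
        have "lo n + int (q 1 n) \<le> i" using that by (auto simp: block_def)
        then show ?thesis using gap short hi_nested[OF m] by linarith
      qed
    qed (use j in auto)
    then show "\<bar>pr (?Z \<union> hit_constraints 1 q a lo hi n)
        - (\<Prod>i = 1..1. pr (block (a i n) 0 (lo n) (hi n))) * pr ?Z\<bar> \<le> \<alpha> j * pr ?Z"
      by (simp add: hit_constraints_def shift mult.commute)
  qed (use assms \<alpha>_nonneg \<alpha>_summable in \<open>auto simp: hit_constraints_def shift\<close>)
  show ?thesis
    using AE_hit_process_ratio_one[unfolded p_def] top by blast
qed

text \<open>With several translates, those of \<open>m\<close> may lie on both sides of one of
  \<open>n\<close>. This calls for two-sided nesting and \<open>\<psi>\<close>-mixing; splitting off
  \<open>l\<close> blocks gives the error \<open>7 * l * \<alpha> j\<close>.\<close>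

lemma (in psi_mixing_shift) psi_ratio_one:
  fixes l :: nat and q :: "nat \<Rightarrow> nat \<Rightarrow> nat" and a :: "nat \<Rightarrow> nat \<Rightarrow> int \<Rightarrow> 'a"
    and lo hi :: "nat \<Rightarrow> int" and M D :: nat
  assumes l: "1 \<le> l"
    and fibre: "\<And>i k F. i \<in> {1..l} \<Longrightarrow> finite F \<Longrightarrow> card {n \<in> F. q i n = k} \<le> M"
    and fibre_diff: "\<And>i i' k F. i \<in> {1..l} \<Longrightarrow> i' \<in> {1..l} \<Longrightarrow> i \<noteq> i' \<Longrightarrow> finite F \<Longrightarrow>
      card {n \<in> F. int (q i n) - int (q i' n) = k} \<le> M"
    and fibre_max: "\<And>m F. finite F \<Longrightarrow>
      card {n \<in> F. m < n \<and> Max ((\<lambda>i. q i n) ` {1..l}) \<le> Max ((\<lambda>i. q i m) ` {1..l})} \<le> M"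
    and lo_le_hi: "\<And>n. 1 \<le> n \<Longrightarrow> lo n \<le> hi n"
    and hi_nested: "\<And>m n. 1 \<le> m \<Longrightarrow> m < n \<Longrightarrow> hi m \<le> hi n + int D"
    and lo_nested: "\<And>m n. 1 \<le> m \<Longrightarrow> m < n \<Longrightarrow> lo n \<le> lo m + int D"
    and top: "filterlim (\<lambda>N. \<Sum>n = 1..N. \<Prod>i = 1..l. pr (block (a i n) 0 (lo n) (hi n))) at_top sequentially"
  shows "AE \<omega> in P. (\<lambda>N. (\<Sum>n = 1..N. indicator (fixing (hit_constraints l q a lo hi n)) \<omega>)
    / (\<Sum>n = 1..N. \<Prod>i = 1..l. pr (block (a i n) 0 (lo n) (hi n)))) \<longlonglongrightarrow> 1"
proof -
  have "\<alpha> \<longlonglongrightarrow> 0" by (rule summable_LIMSEQ_zero[OF \<alpha>_summable])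
  then have "eventually (\<lambda>k. \<alpha> k < 1 / 2) sequentially"
    by (rule order_tendstoD) simp
  \<comment> \<open>From \<open>j0\<close> on the rate is small enough for the two-sided product
    estimate.\<close>
  then obtain j0 where j0: "\<And>j. j0 \<le> j \<Longrightarrow> \<alpha> j \<le> 1 / 2"
    unfolding eventually_sequentially by (meson less_imp_le)
  have shift: "pr (block b (int k) u v) = pr (block b 0 u v)" for b k u v
    using pr_block_shift[of b 0 k u v] by simp
  have estimate: "\<bar>pr (Z \<union> hit_constraints l q a lo hi n)
      - (\<Prod>i = 1..l. pr (block (a i n) 0 (lo n) (hi n))) * pr Z\<bar> \<le> 7 * real l * \<alpha> j * pr Z"
    if j: "j0 \<le> j" "1 \<le> j" and n: "1 \<le> n" and short: "hi n - lo n + 1 < int j" and fin: "finite Z"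
      and sep: "\<And>i i'. i \<in> {1..l} \<Longrightarrow> i' \<in> {1..l} \<Longrightarrow> i \<noteq> i' \<Longrightarrow> 2 * int j + int D \<le> \<bar>int (q i n) - int (q i' n)\<bar>"
      and Z: "\<And>k i c. k \<in> {1..l} \<Longrightarrow> (i, c) \<in> Z \<Longrightarrow> i + int j \<le> lo n + int (q k n) \<or> hi n + int (q k n) + int j \<le> i"
    for Z j n
  proof -
    have "\<bar>pr (Z \<union> (\<Union>k\<in>{1..l}. block (a k n) (int (q k n)) (lo n) (hi n)))
        - (\<Prod>k\<in>{1..l}. pr (block (a k n) (int (q k n)) (lo n) (hi n))) * pr Z\<bar>
      \<le> 7 * real (card {1..l}) * \<alpha> j * pr Z"
    proof (rule pr_UN_separated)
      show "hi n - lo n + int j \<le> \<bar>int (q k n) - int (q k' n)\<bar>" if "k \<in> {1..l}" "k' \<in> {1..l}" "k \<noteq> k'" for k k'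
        using sep[OF that] short by linarith
      show "i + int j \<le> lo n + int (q k n) \<or> hi n + int (q k n) + int j \<le> i"
        if "k \<in> {1..l}" "(i, c) \<in> Z" for k i c
        by (rule Z[OF that])
    qed (use j j0 fin lo_le_hi[OF n] in auto)
    then show ?thesis by (simp add: hit_constraints_def shift)
  qed
  interpret hit_process P \<alpha> l q a lo hi M D j0 "\<lambda>j. 7 * real l * \<alpha> j"
  proof
    show "summable (\<lambda>j. 7 * real l * \<alpha> j)" by (intro summable_mult \<alpha>_summable)
    show "0 \<le> 7 * real l * \<alpha> j" for j using \<alpha>_nonneg by simp
  next
    fix j n :: nat
    assume j: "j0 \<le> j" "1 \<le> j" and n: "1 \<le> n" and short: "hi n - lo n + 1 < int j"
      and sep: "\<And>i i'. i \<in> {1..l} \<Longrightarrow> i' \<in> {1..l} \<Longrightarrow> i \<noteq> i' \<Longrightarrow> 2 * int j + int D \<le> \<bar>int (q i n) - int (q i' n)\<bar>"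
    show "\<bar>pr (hit_constraints l q a lo hi n) - (\<Prod>i = 1..l. pr (block (a i n) 0 (lo n) (hi n)))\<bar> \<le> 7 * real l * \<alpha> j"
      using estimate[OF j n short finite.emptyI sep] by simp
  next
    fix j m n :: nat
    assume j: "j0 \<le> j" "1 \<le> j" and m: "1 \<le> m" "m < n" and short: "hi n - lo n + 1 < int j"
      and sep: "\<And>i i'. i \<in> {1..l} \<Longrightarrow> i' \<in> {1..l} \<Longrightarrow> i \<noteq> i' \<Longrightarrow> 2 * int j + int D \<le> \<bar>int (q i n) - int (q i' n)\<bar>"
      and sep': "\<And>i i'. i \<in> {1..l} \<Longrightarrow> i' \<in> {1..l} \<Longrightarrow> 2 * int j + int D \<le> \<bar>int (q i m) - int (q i' n)\<bar>"
    show "\<bar>pr (hit_constraints l q a lo hi m \<union> hit_constraints l q a lo hi n)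
        - (\<Prod>i = 1..l. pr (block (a i n) 0 (lo n) (hi n))) * pr (hit_constraints l q a lo hi m)\<bar>
      \<le> 7 * real l * \<alpha> j * pr (hit_constraints l q a lo hi m)"
    proof (rule estimate[OF j _ short _ sep])
      fix k i c
      assume k: "k \<in> {1..l}" and "(i, c) \<in> hit_constraints l q a lo hi m"
      then obtain i' where i': "i' \<in> {1..l}" "lo m + int (q i' m) \<le> i" "i \<le> hi m + int (q i' m)"
        by (auto simp: hit_constraints_def block_def)
      show "i + int j \<le> lo n + int (q k n) \<or> hi n + int (q k n) + int j \<le> i"
        \<comment> \<open>Of the separation \<open>2 * j + D\<close>, nesting uses up
          \<open>D\<close>, the length of the short cylinder uses less than \<open>j\<close>, and a
          gap \<open>j\<close> remains on whichever side the point lies.\<close>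
        using sep'[OF i'(1) k] i'(2,3) short hi_nested[OF m] lo_nested[OF m] by linarith
    qed (use m in auto)
  qed (use l fibre fibre_diff fibre_max lo_le_hi hi_nested in auto)
  show ?thesis
    using AE_hit_process_ratio_one[unfolded p_def] top by blast
qed

section \<open>Translation of the hypotheses and conclusion\<close>

lemma prod_indicator:
  "finite I \<Longrightarrow> (\<Prod>i\<in>I. indicator (A i) x) = (indicator (\<Inter>i\<in>I. A i) x :: real)"
  by (induction I rule: finite_induct) (auto simp: indicator_def)

lemma count_at_most_card_le:
  assumes "count_at_most A K" "S \<subseteq> A"
  shows "card S \<le> nat \<lceil>K\<rceil>"
proof -
  have "real (card S) \<le> K"
    using assms card_mono[of A S] by (auto simp: count_at_most_def)
  then show ?thesis by linarith
qed

theorem theorem2p3: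
  fixes P :: "(int \<Rightarrow> 'a::countable) measure"
    and l :: nat
    and q :: "nat \<Rightarrow> nat \<Rightarrow> nat"
    and K D :: real
    and C :: "nat \<Rightarrow> nat \<Rightarrow> (int \<Rightarrow> 'a) set"
    and lo hi :: "nat \<Rightarrow> int"
  assumes alphabet: "\<exists>a b :: 'a. a \<noteq> b"
    and prob: "prob_space P"
    and sets_P: "sets P = sets full_shift_space"
    and invariant: "shift_invariant P"
    and letters: "\<And>a :: 'a. measure P {\<omega>. \<omega> 0 = a} > 0"
    and l_ge_1: "l \<ge> 1"
    and K_pos: "K > 0"
    and cond_a: "\<And>i j (k::int). i \<in> {1..l} \<Longrightarrow> j \<in> {1..l} \<Longrightarrow> i \<noteq> j \<Longrightarrow>
      count_at_most {n. int (q i n) - int (q j n) = k \<or> int (q i n) = k} K"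
    and cond_a_single: "\<And>k::int. l = 1 \<Longrightarrow> count_at_most {n. int (q 1 n) = k} K"
    and cond_b: "count_at_most
      {(m, n). m < n \<and> Max ((\<lambda>i. q i n) ` {1..l}) \<le> Max ((\<lambda>i. q i m) ` {1..l})} K"
    and cylinders: "\<And>i n. i \<in> {1..l} \<Longrightarrow> n \<ge> 1 \<Longrightarrow> cylinder_on (lo n) (hi n) (C i n)"
    and D_pos: "D > 0"
    and diverges: "filterlim (\<lambda>N. prob_sum P l C N) at_top sequentially"
  shows "(l = 1 \<longrightarrow>
        (\<Sum>n. phi_coeff P (Suc n)) < \<infinity> \<longrightarrow>
        (\<forall>m n. 1 \<le> m \<and> m < n \<longrightarrow> right_nested D (lo m) (hi m) (lo n) (hi n)) \<longrightarrow>
        (AE \<omega> in P. (\<lambda>N. hit_sum l q C N \<omega> / prob_sum P l C N) \<longlonglongrightarrow> 1))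
    \<and> (l > 1 \<longrightarrow>
        (\<Sum>n. psi_coeff P (Suc n)) < \<infinity> \<longrightarrow>
        (\<forall>m n. 1 \<le> m \<and> m < n \<longrightarrow> nested D (lo m) (hi m) (lo n) (hi n)) \<longrightarrow>
        (AE \<omega> in P. (\<lambda>N. hit_sum l q C N \<omega> / prob_sum P l C N) \<longlonglongrightarrow> 1))"
proof -
  interpret prob_space P by (rule prob)
  interpret shift_process P
    by unfold_locales (rule sets_P invariant)+
  define M where "M = nat \<lceil>K\<rceil>"
  define D' where "D' = nat \<lceil>D\<rceil>"
  have "\<exists>b. lo n \<le> hi n \<and> C i n = fixing (block b 0 (lo n) (hi n))" if "i \<in> {1..l}" "1 \<le> n" for i n
    using cylinders[OF that] unfolding cylinder_on_eq_block by blast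
  then obtain a where a: "\<And>i n. i \<in> {1..l} \<Longrightarrow> 1 \<le> n \<Longrightarrow> lo n \<le> hi n \<and> C i n = fixing (block (a i n) 0 (lo n) (hi n))"
    by metis
  have lo_le_hi: "lo n \<le> hi n" if "1 \<le> n" for n
    using a[of 1 n] l_ge_1 that by simp
  have fibre: "card {n \<in> F. q i n = k} \<le> M" if i: "i \<in> {1..l}" for i k F
  proof (cases "l = 1")
    case True
    then show ?thesis
      unfolding M_def using i by (intro count_at_most_card_le[OF cond_a_single[of "int k"]]) auto
  next
    case False
    \<comment> \<open>Condition (a) speaks of two distinct indices, so bounding the fibres of
      \<open>q i\<close> takes some partner \<open>i'\<close>.\<close>
    then obtain i' where i': "i' \<in> {1..l}" "i \<noteq> i'"
      using i l_ge_1 by (cases "i = 1") (force intro: that[of 2], force intro: that[of 1])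
    show ?thesis
      unfolding M_def by (rule count_at_most_card_le[OF cond_a[OF i i', of "int k"]]) auto
  qed
  have fibre_diff: "card {n \<in> F. int (q i n) - int (q i' n) = k} \<le> M"
    if "i \<in> {1..l}" "i' \<in> {1..l}" "i \<noteq> i'" for i i' k F
    unfolding M_def by (rule count_at_most_card_le[OF cond_a[OF that, of k]]) auto
  have fibre_max: "card {n \<in> F. m < n \<and> Max ((\<lambda>i. q i n) ` {1..l}) \<le> Max ((\<lambda>i. q i m) ` {1..l})} \<le> M" for m F
  proof -
    let ?S = "{n \<in> F. m < n \<and> Max ((\<lambda>i. q i n) ` {1..l}) \<le> Max ((\<lambda>i. q i m) ` {1..l})}"
    \<comment> \<open>For fixed \<open>m\<close> the exceptional \<open>n\<close> inject into the
      exceptional pairs of condition (b).\<close>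
    have "card ?S = card (Pair m ` ?S)"
      by (simp add: card_image inj_on_def)
    also have "\<dots> \<le> M"
      unfolding M_def by (rule count_at_most_card_le[OF cond_b]) auto
    finally show ?thesis .
  qed
  have prob_sum_eq: "prob_sum P l C N = (\<Sum>n = 1..N. \<Prod>i = 1..l. pr (block (a i n) 0 (lo n) (hi n)))" for N
    unfolding prob_sum_def using a by (intro sum.cong prod.cong refl) auto
  have hit_sum_eq: "hit_sum l q C N \<omega> = (\<Sum>n = 1..N. indicator (fixing (hit_constraints l q a lo hi n)) \<omega>)" for N \<omega>
    unfolding hit_sum_def
  proof (intro sum.cong refl)
    fix n assume n: "n \<in> {1..N}"
    have "(\<Prod>i = 1..l. indicator (C i n) ((left_shift ^^ q i n) \<omega>) :: real)
        = (\<Prod>i = 1..l. indicator (fixing (block (a i n) (int (q i n)) (lo n) (hi n))) \<omega>)"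
      using a n by (intro prod.cong refl) (auto simp: indicator_def left_shift_in_fixing_block)
    also have "\<dots> = indicator (\<Inter>i\<in>{1..l}. fixing (block (a i n) (int (q i n)) (lo n) (hi n))) \<omega>"
      by (rule prod_indicator) simp
    finally show "(\<Prod>i = 1..l. indicator (C i n) ((left_shift ^^ q i n) \<omega>) :: real)
        = indicator (fixing (hit_constraints l q a lo hi n)) \<omega>"
      by (simp add: hit_constraints_def fixing_UN)
  qed
  have top: "filterlim (\<lambda>N. \<Sum>n = 1..N. \<Prod>i = 1..l. pr (block (a i n) 0 (lo n) (hi n))) at_top sequentially"
    using diverges unfolding prob_sum_eq .
  show ?thesis
    unfolding hit_sum_eq prob_sum_eq
  proof (intro conjI impI)
    assume l: "l = 1" and phi: "(\<Sum>n. phi_coeff P (Suc n)) < \<infinity>"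
      and nest: "\<forall>m n. 1 \<le> m \<and> m < n \<longrightarrow> right_nested D (lo m) (hi m) (lo n) (hi n)"
    interpret phi_mixing_shift P "\<lambda>k. enn2real (phi_coeff P k)"
    proof
      fix k x and Z V :: "(int \<times> 'a) set"
      assume *: "1 \<le> k" "finite Z" "finite V" "\<And>i a. (i, a) \<in> Z \<Longrightarrow> i \<le> x" "\<And>i a. (i, a) \<in> V \<Longrightarrow> x + int k \<le> i"
      show "\<bar>pr (Z \<union> V) - pr Z * pr V\<bar> \<le> enn2real (phi_coeff P k) * pr Z"
        by (rule phi_coeff_mixing[OF summable_enn2real_Suc(2)[OF phi *(1)] *(2,3)]) (use *(4,5) in blast)+
    qed (use alphabet letters summable_enn2real_Suc(1)[OF phi] in auto)
    have "hi m \<le> hi n + int D'" if "1 \<le> m" "m < n" for m n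
    proof -
      have "real_of_int (hi m) < real_of_int (hi n) + D"
        using nest that by (auto simp: right_nested_def)
      then show ?thesis unfolding D'_def by linarith
    qed
    then show "AE \<omega> in P. (\<lambda>N. (\<Sum>n = 1..N. indicator (fixing (hit_constraints l q a lo hi n)) \<omega>) /
        (\<Sum>n = 1..N. \<Prod>i = 1..l. pr (block (a i n) 0 (lo n) (hi n)))) \<longlonglongrightarrow> 1"
      using phi_single_ratio_one[of q M lo hi D' a] fibre[of 1] fibre_max lo_le_hi top unfolding l by simp
  next
    assume psi: "(\<Sum>n. psi_coeff P (Suc n)) < \<infinity>"
      and nest: "\<forall>m n. 1 \<le> m \<and> m < n \<longrightarrow> nested D (lo m) (hi m) (lo n) (hi n)"
    interpret psi_mixing_shift P "\<lambda>k. enn2real (psi_coeff P k)"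
    proof
      fix k x and Z V :: "(int \<times> 'a) set"
      assume *: "1 \<le> k" "finite Z" "finite V" "\<And>i a. (i, a) \<in> Z \<Longrightarrow> i \<le> x" "\<And>i a. (i, a) \<in> V \<Longrightarrow> x + int k \<le> i"
      show "\<bar>pr (Z \<union> V) - pr Z * pr V\<bar> \<le> enn2real (psi_coeff P k) * (pr Z * pr V)"
        by (rule psi_coeff_mixing[OF summable_enn2real_Suc(2)[OF psi *(1)] *(2,3)]) (use *(4,5) in blast)+
      \<comment> \<open>The one-sided bound follows with the same rate, as
        \<open>pr V \<le> 1\<close>.\<close>
      also have "\<dots> \<le> enn2real (psi_coeff P k) * pr Z"
        by (intro mult_left_mono mult_left_le) auto
      finally show "\<bar>pr (Z \<union> V) - pr Z * pr V\<bar> \<le> enn2real (psi_coeff P k) * pr Z" .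
    qed (use alphabet letters summable_enn2real_Suc(1)[OF psi] in auto)
    have "hi m \<le> hi n + int D' \<and> lo n \<le> lo m + int D'" if "1 \<le> m" "m < n" for m n
    proof -
      have "real_of_int ` {lo m..hi m} \<subseteq> {real_of_int (lo n) - D <..< real_of_int (hi n) + D}"
        using nest that by (simp add: nested_def)
      \<comment> \<open>As \<open>lo m \<le> hi m\<close>, both endpoints belong to the nested
        interval and can be tested.\<close>
      then have "real_of_int (hi m) < real_of_int (hi n) + D" "real_of_int (lo n) - D < real_of_int (lo m)"
        using lo_le_hi[OF that(1)] by (auto simp: image_subset_iff)
      then show ?thesis unfolding D'_def by linarith
    qed
    then show "AE \<omega> in P. (\<lambda>N. (\<Sum>n = 1..N. indicator (fixing (hit_constraints l q a lo hi n)) \<omega>) /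
        (\<Sum>n = 1..N. \<Prod>i = 1..l. pr (block (a i n) 0 (lo n) (hi n)))) \<longlonglongrightarrow> 1"
      by (intro psi_ratio_one[where M = M and D = D'] l_ge_1 fibre fibre_diff fibre_max lo_le_hi top) auto
  qed
qed

end
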